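(* Let $1\ll n_1=\lambda n_2$ for a constant $0<\lambda\leq 1$, and let $G=G(n_1,n_2,p)$ where $(n_1n_2)^{-\frac{1}{2}}\ll p\ll (n_1n_2)^{-\frac{1}{2}+o(1)}$. Then whp $$(1-o(1))\frac{1}{2}pn_1n_2\leq g(G)\leq \frac{1}{2}pn_1n_2.$$
   Context: $G(n_1,n_2,p)$ denotes the binomial random bipartite graph: a random subgraph of $K_{n_1,n_2}$ (partition classes of sizes $n_1,n_2$) in which each edge is included independently with probability $p$. $g(G)$ is the genus of $G$. The notation $f\ll g$ means $f/g\to0$; $1\ll n_1$ means $n_1\to\infty$; "whp" means with probability tending to $1$ as $n_1\to\infty$; $o(1)$ denotes a quantity tending to $0$. *)

theory Defs
  imports "HOL-Analysis.Analysis" "HOL-Library.Landau_Symbols"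
begin

text \<open>A finite simple graph is given by its edge set E, a finite set of 2-element
  vertex sets. Isolated vertices do not affect the genus.\<close>

definition darts :: "'a set set \<Rightarrow> ('a \<times> 'a) set" where
  "darts E = {(u, v). {u, v} \<in> E}"

text \<open>A rotation system: a permutation of the darts that fixes the tail and cyclically
  permutes all darts leaving each vertex (i.e. a cyclic ordering of each vertex's
  neighbours). Rotation systems correspond exactly to cellular embeddings into
  orientable surfaces.\<close>
definition rotation_system :: "'a set set \<Rightarrow> ('a \<times> 'a \<Rightarrow> 'a \<times> 'a) \<Rightarrow> bool" where
  "rotation_system E \<sigma> \<longleftrightarrow>
     bij_betw \<sigma> (darts E) (darts E) \<and>
     (\<forall>d\<in>darts E. fst (\<sigma> d) = fst d) \<and>
     (\<forall>u v w. (u, v) \<in> darts E \<longrightarrow> (u, w) \<in> darts E \<longrightarrow> (\<exists>n. (\<sigma> ^^ n) (u, v) = (u, w)))"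

definition face_perm :: "('a \<times> 'a \<Rightarrow> 'a \<times> 'a) \<Rightarrow> 'a \<times> 'a \<Rightarrow> 'a \<times> 'a" where
  "face_perm \<sigma> = (\<lambda>(u, v). \<sigma> (v, u))"

definition num_faces :: "'a set set \<Rightarrow> ('a \<times> 'a \<Rightarrow> 'a \<times> 'a) \<Rightarrow> nat" where
  "num_faces E \<sigma> = card {{e \<in> darts E. \<exists>n. (face_perm \<sigma> ^^ n) d = e} | d. d \<in> darts E}"

definition adj :: "'a set set \<Rightarrow> 'a \<Rightarrow> 'a \<Rightarrow> bool" where
  "adj E u v \<longleftrightarrow> {u, v} \<in> E"

definition num_edge_components :: "'a set set \<Rightarrow> nat" where
  "num_edge_components E = card {{w. (adj E)\<^sup>*\<^sup>* v w} | v. v \<in> \<Union>E}"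

text \<open>Orientable genus: for each nontrivial component C, g(C) = min over rotation systems
  of (2 - V_C + E_C - F_C)/2 (Heffter--Edmonds), and g(G) is the sum over components
  (Battle--Harary--Kodama--Youngs). Rotation systems of G are products of rotation
  systems of its components, so the minimum of the sum is the sum of minima.\<close>
definition genus :: "'a set set \<Rightarrow> nat" where
  "genus E = (LEAST g. \<exists>\<sigma>. rotation_system E \<sigma> \<and>
      2 * int g = 2 * int (num_edge_components E) - int (card (\<Union>E)) + int (card E)
                  - int (num_faces E \<sigma>))"

definition bip_edges :: "(nat \<times> nat) set \<Rightarrow> (nat + nat) set set" where
  "bip_edges S = {{Inl i, Inr j} | i j. (i, j) \<in> S}"

definition Gnp_prob :: "nat \<Rightarrow> nat \<Rightarrow> real \<Rightarrow> ((nat \<times> nat) set \<Rightarrow> bool) \<Rightarrow> real" where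
  "Gnp_prob n1 n2 p P =
     (\<Sum>S\<in>Pow ({..<n1} \<times> {..<n2}).
        if P S then p ^ card S * (1 - p) ^ (n1 * n2 - card S) else 0)"

end

theory Submission
  imports Defs
begin

text \<open>By Euler's formula, twice the genus is \<open>2 c - V + e - F\<close> minimised over rotation systems,
  where \<open>c\<close> counts nontrivial components. The upper bound uses \<open>F \<ge> c\<close>: in a bipartite graph \<open>c\<close> is at
  most the number of nonisolated right vertices, so \<open>2 g\<close> is at most \<open>e\<close> minus the number of nonisolated
  left vertices. The latter is whp at least \<open>n1 / 2\<close>, which exceeds the fluctuations of \<open>e\<close>. For the lower
  bound, a face either has length more than \<open>K\<close> (at most \<open>2 e / K\<close> faces), or backtracks at a vertex of
  degree one (at most \<open>V\<close> faces), or runs along a cycle of length at most \<open>K\<close>. The expected number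
  of such cycles is at most a constant times \<open>(n p) ^ K = n ^ o(1)\<close>, and both this and \<open>V\<close> are negligible
  against \<open>p n1 n2\<close>.\<close>

section \<open>Orbits of permutations\<close>

text \<open>\<open>genus\<close> is a LEAST over natural numbers, so it carries information only
  once some rotation system is known whose Euler defect is even and nonnegative. Rather than
  controlling the defect of an arbitrary one, a suitable one is grown edge by edge from the empty
  graph, each insertion changing the defect by 0 or 2. Inserting an edge acts on the face
  permutation by transpositions, which is why orbits under products with a transposition are
  studied. Both face bounds hold for every rotation system and are applied to one that attains the
  genus. The edge count is allowed to deviate by n1 / 4, half of what the nonisolated left vertices
  provide. Chebyshev then costs 16 p n2 / n1 = 16 p / lam, which vanishes because p tends to 0. The
  cycle length bound K has to grow as the relative error \<eta> shrinks, while the upper bound on p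
  controls (n p) ^ K only for fixed K. Hence the limit is proved for each fixed \<eta>, and a
  diagonal sequence then gives a single error function tending to 0.\<close>

definition orb :: "('a \<Rightarrow> 'a) \<Rightarrow> 'a set \<Rightarrow> 'a \<Rightarrow> 'a set" where
  "orb f S d = {e \<in> S. \<exists>n. (f ^^ n) d = e}"

definition orbs :: "('a \<Rightarrow> 'a) \<Rightarrow> 'a set \<Rightarrow> 'a set set" where
  "orbs f S = orb f S ` S"

text \<open>This is f precomposed with the transposition of a and b. On permutations it splices two
  cycles into one or cuts one cycle in two.\<close>

definition swap_vals :: "('a \<Rightarrow> 'b) \<Rightarrow> 'a \<Rightarrow> 'a \<Rightarrow> 'a \<Rightarrow> 'b" where
  "swap_vals f a b = f(a := f b, b := f a)"

lemma funpow_closed: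
  assumes "\<And>x. x \<in> S \<Longrightarrow> f x \<in> S" "d \<in> S"
  shows "(f ^^ n) d \<in> S"
  using assms by (induction n) auto

lemma funpow_cong_on:
  assumes "\<And>x. x \<in> S \<Longrightarrow> f x \<in> S" "\<And>x. x \<in> S \<Longrightarrow> f x = g x" "d \<in> S"
  shows "(f ^^ n) d = (g ^^ n) d"
proof (induction n)
  case (Suc n)
  then show ?case
    using assms(2)[of "(f ^^ n) d"] funpow_closed[of S f d n] assms by simp
qed simp

text \<open>The forward orbit never leaves the closed set S, so neither the values of g outside S
  nor the larger ambient set T can be noticed. This transfers orbits between a graph and its
  extension by an edge.\<close>

lemma orb_cong:
  assumes "\<And>x. x \<in> S \<Longrightarrow> f x \<in> S" "\<And>x. x \<in> S \<Longrightarrow> f x = g x" "d \<in> S" "S \<subseteq> T"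
  shows "orb f S d = orb g T d"
proof -
  have eq: "(f ^^ n) d = (g ^^ n) d" for n
    by (rule funpow_cong_on[of S]) (use assms in auto)
  have "(g ^^ n) d \<in> S" for n
    using funpow_closed[of S f d n] assms eq by simp
  then show ?thesis
    using assms(4) by (auto simp: orb_def eq)
qed

lemma orb_refl: "d \<in> S \<Longrightarrow> d \<in> orb f S d"
  unfolding orb_def by (auto intro: exI[of _ 0])

lemma orb_subset: "orb f S d \<subseteq> S"
  by (auto simp: orb_def)

lemma orb_step:
  assumes "\<And>x. x \<in> S \<Longrightarrow> f x \<in> S" "d \<in> S"
  shows "f d \<in> orb f S d"
  unfolding orb_def using assms by (auto intro: exI[of _ 1])

lemma orb_trans: "e \<in> orb f S d \<Longrightarrow> c \<in> orb f S e \<Longrightarrow> c \<in> orb f S d"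
  unfolding orb_def
proof clarsimp
  fix n m assume "(f ^^ m) ((f ^^ n) d) \<in> S"
  show "\<exists>k. (f ^^ k) d = (f ^^ m) ((f ^^ n) d)"
    by (rule exI[of _ "m + n"]) (simp add: funpow_add)
qed

lemma orb_invariant:
  assumes "\<And>x. x \<in> S \<Longrightarrow> f x \<in> S" "\<And>x. x \<in> S \<Longrightarrow> L (f x) = L x" "d \<in> S" "e \<in> orb f S d"
  shows "L e = L d"
proof -
  obtain n where n: "(f ^^ n) d = e" using assms(4) by (auto simp: orb_def)
  have "L ((f ^^ n) d) = L d"
  proof (induction n)
    case (Suc n)
    then show ?case using assms(2)[of "(f ^^ n) d"] funpow_closed[of S f d n] assms by simp
  qed simp
  then show ?thesis using n by simp
qed

lemma funpow_period:
  assumes "finite S" "bij_betw f S S" "d \<in> S"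
  obtains m where "m > 0" "(f ^^ m) d = d"
proof -
  have cl: "x \<in> S \<Longrightarrow> f x \<in> S" for x using assms(2) by (auto simp: bij_betw_def)
  have "range (\<lambda>n. (f ^^ n) d) \<subseteq> S" using funpow_closed[of S f d] cl assms by auto
  then have "\<not> inj (\<lambda>n. (f ^^ n) d)"
    using assms(1) finite_subset infinite_UNIV_nat finite_imageD by blast
  then obtain i j where ij: "i < j" "(f ^^ i) d = (f ^^ j) d"
    unfolding inj_def by (metis linorder_neqE_nat)
  have "inj_on (f ^^ i) S" using bij_betw_funpow[OF assms(2), of i] by (simp add: bij_betw_def)
  moreover have "(f ^^ i) ((f ^^ (j - i)) d) = (f ^^ i) d"
    using ij by (metis funpow_add le_add_diff_inverse less_imp_le o_apply)
  ultimately have "(f ^^ (j - i)) d = d"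
    using funpow_closed[of S f d "j - i"] cl assms(3) by (auto dest: inj_onD)
  then show ?thesis using that[of "j - i"] ij by simp
qed

text \<open>Forward iterates suffice on a finite set: if d has period m, then m * n - n further
  steps undo n steps. Positivity of m keeps the truncated subtraction exact.\<close>

lemma orb_sym:
  assumes "finite S" "bij_betw f S S" "d \<in> S" "e \<in> orb f S d"
  shows "d \<in> orb f S e"
proof -
  obtain n where n: "(f ^^ n) d = e" "e \<in> S" using assms(4) by (auto simp: orb_def)
  obtain m where m: "m > 0" "(f ^^ m) d = d" using funpow_period[OF assms(1-3)] .
  have "(f ^^ (m * k)) d = d" for k
    by (induction k) (simp_all add: funpow_add m(2))
  then have "(f ^^ (m * n)) d = d" .
  moreover have "m * n = (m * n - n) + n" using m by simp
  ultimately have "(f ^^ (m * n - n)) e = d"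
    using n by (metis funpow_add o_apply)
  then show ?thesis using assms(3) by (auto simp: orb_def)
qed

lemma orb_eq:
  assumes "finite S" "bij_betw f S S" "d \<in> S" "e \<in> orb f S d"
  shows "orb f S e = orb f S d"
  using orb_sym[OF assms] orb_trans[of e f S d] orb_trans[of d f S e] assms(4) by blast

lemma orb_eq_iff:
  assumes "finite S" "bij_betw f S S" "d \<in> S" "e \<in> S"
  shows "orb f S e = orb f S d \<longleftrightarrow> e \<in> orb f S d"
  using orb_eq[OF assms(1-3)] orb_refl[OF assms(4)] by blast

section \<open>Orbits after multiplication by a transposition\<close>

lemma bij_swap_vals:
  assumes "finite S" "bij_betw f S S" "a \<in> S" "b \<in> S"
  shows "bij_betw (swap_vals f a b) S S"
proof -
  have inj: "inj_on f S" and img: "f ` S = S" using assms(2) by (auto simp: bij_betw_def)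
  have "inj_on (swap_vals f a b) S"
    using inj assms(3,4) unfolding inj_on_def swap_vals_def by auto
  moreover have "swap_vals f a b ` S \<subseteq> S"
    using img assms(3,4) unfolding swap_vals_def by auto
  ultimately show ?thesis
    using assms(1) by (simp add: bij_betw_def endo_inj_surj)
qed

lemma swap_vals_commute: "swap_vals f a b = swap_vals f b a"
  unfolding swap_vals_def by auto

lemma swap_vals_involutive: "swap_vals (swap_vals f a b) a b = f"
  unfolding swap_vals_def by auto

text \<open>Before its first visit to b, the f-path from x meets neither b nor a (from a it could
  not reach b), so the swap is invisible along it.\<close>

lemma swap_vals_reach:
  assumes "finite S" "bij_betw f S S" "a \<in> S" "b \<in> S" "b \<notin> orb f S a" "x \<in> orb f S b"
  shows "b \<in> orb (swap_vals f a b) S x"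
proof -
  let ?g = "swap_vals f a b"
  have xS: "x \<in> S" using assms(6) by (auto simp: orb_def)
  have "b \<in> orb f S x" by (rule orb_sym) (use assms in auto)
  then have ex: "\<exists>n. (f ^^ n) x = b" by (auto simp: orb_def)
  define n where "n = (LEAST n. (f ^^ n) x = b)"
  have n: "(f ^^ n) x = b" unfolding n_def by (rule LeastI_ex[OF ex])
  have nb: "(f ^^ i) x \<noteq> b" if "i < n" for i using that not_less_Least unfolding n_def by blast
  have na: "(f ^^ i) x \<noteq> a" if "i < n" for i
  proof
    assume h: "(f ^^ i) x = a"
    have "(f ^^ (n - i)) ((f ^^ i) x) = (f ^^ n) x"
      using that by (metis funpow_add le_add_diff_inverse2 less_imp_le o_apply)
    then have "b \<in> orb f S a" using h n assms(4) by (auto simp: orb_def)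
    then show False using assms(5) by simp
  qed
  have "i \<le> n \<Longrightarrow> (?g ^^ i) x = (f ^^ i) x" for i
  proof (induction i)
    case (Suc i)
    then show ?case using na[of i] nb[of i] by (simp add: swap_vals_def)
  qed simp
  then have "(?g ^^ n) x = b" using n by simp
  then show ?thesis using assms(4) by (auto simp: orb_def)
qed

text \<open>After the swap, a is followed by f b, from where the old path runs through the orbit of
  b up to b; then b is followed by f a, and the path runs back to a. The two cycles become one, and
  cycles containing neither point are untouched.\<close>

lemma orb_swap_vals_merge:
  assumes "finite S" "bij_betw f S S" "a \<in> S" "b \<in> S" "b \<notin> orb f S a" "x \<in> S"
  shows "orb (swap_vals f a b) S x =
    (if x \<in> orb f S a \<union> orb f S b then orb f S a \<union> orb f S b else orb f S x)"
proof -
  let ?g = "swap_vals f a b" and ?U = "orb f S a \<union> orb f S b"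
  have cl: "x \<in> S \<Longrightarrow> f x \<in> S" for x using assms(2) by (auto simp: bij_betw_def)
  have bg: "bij_betw ?g S S" by (rule bij_swap_vals) (use assms in auto)
  have clg: "x \<in> S \<Longrightarrow> ?g x \<in> S" for x using bg by (auto simp: bij_betw_def)
  have ab: "a \<notin> orb f S b" using assms orb_sym[of S f b a] by blast
  have Uf: "f x \<in> ?U" if "x \<in> ?U" for x
  proof -
    have "x \<in> S" using that orb_subset[of f S] by blast
    then show ?thesis using that orb_trans[of x f S _ "f x"] orb_step[of S f x] cl by blast
  qed
  have Ug: "?g x \<in> ?U" if "x \<in> ?U" for x
    using Uf[of x] that Uf[of a] Uf[of b] orb_refl[OF assms(3), of f] orb_refl[OF assms(4), of f]
    by (auto simp: swap_vals_def)
  show ?thesis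
  proof (cases "x \<in> ?U")
    case True
    have ra: "a \<in> orb ?g S z" if "z \<in> orb f S a" for z
      using swap_vals_reach[of S f b a z] assms ab that by (simp add: swap_vals_commute)
    have rb: "b \<in> orb ?g S z" if "z \<in> orb f S b" for z
      using swap_vals_reach[of S f a b z] assms that by simp
    have "?g a \<in> orb f S b"
      using orb_step[of S f b] cl assms by (auto simp: swap_vals_def)
    then have "b \<in> orb ?g S (?g a)" by (rule rb)
    then have b_a: "b \<in> orb ?g S a"
      using orb_step[of S ?g a] clg assms(3) orb_trans by metis
    have a_b: "a \<in> orb ?g S b" by (rule orb_sym) (use assms bg b_a in auto)
    have to_a: "a \<in> orb ?g S z" if "z \<in> ?U" for z
      using that ra rb a_b orb_trans by fast
    have "?U \<subseteq> orb ?g S x"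
    proof
      fix z assume z: "z \<in> ?U"
      then have "z \<in> S" using orb_subset[of f S] by blast
      then have "z \<in> orb ?g S a" using orb_sym[of S ?g z a] assms bg to_a[OF z] by blast
      then show "z \<in> orb ?g S x" using to_a[OF True] orb_trans by fast
    qed
    moreover have "orb ?g S x \<subseteq> ?U"
      using funpow_closed[of ?U ?g x] Ug True by (auto simp: orb_def)
    ultimately show ?thesis using True by auto
  next
    case False
    \<comment> \<open>Orbits are symmetric, so a point that entered \<open>?U\<close> under f would
      already lie in \<open>?U\<close>. The complement is therefore closed, and f agrees with the
      swapped map on it.\<close>
    have out: "f z \<in> S - ?U" if "z \<in> S - ?U" for z
    proof -
      have "f z \<notin> ?U"
      proof
        assume h: "f z \<in> ?U"
        have "z \<in> orb f S (f z)"
          by (rule orb_sym) (use that assms orb_step[of S f z] cl in auto)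
        then have "z \<in> ?U" using h orb_trans by fast
        then show False using that by simp
      qed
      then show ?thesis using that cl by auto
    qed
    have "orb f S x = orb f (S - ?U) x"
      by (rule orb_cong[symmetric]) (use out False assms in auto)
    also have "\<dots> = orb ?g S x"
      by (rule orb_cong) (use out False assms orb_refl[of a S f] orb_refl[of b S f] in \<open>auto simp: swap_vals_def\<close>)
    finally show ?thesis using False by auto
  qed
qed

text \<open>Stated for an abstract classification \<open>cl\<close> because it is used twice: for
  orbits after a transposition and for components after inserting an edge.\<close>

lemma card_merge_classes:
  assumes "finite S" "a \<in> S" "b \<in> S"
    and eqv: "\<And>x y. x \<in> S \<Longrightarrow> y \<in> S \<Longrightarrow> x \<in> cl y \<longleftrightarrow> cl x = cl y"
    and "cl a \<noteq> cl b"
    and cl': "\<And>x. x \<in> S \<Longrightarrow> cl' x = (if x \<in> cl a \<union> cl b then cl a \<union> cl b else cl x)"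
  shows "card (cl' ` S) + 1 = card (cl ` S)"
proof -
  let ?R = "cl ` S - {cl a, cl b}"
  have "cl' ` S = insert (cl a \<union> cl b) ?R"
  proof (intro set_eqI iffI)
    fix X assume "X \<in> cl' ` S"
    then obtain x where "x \<in> S" "X = cl' x" by auto
    then show "X \<in> insert (cl a \<union> cl b) ?R"
      using cl'[of x] eqv[of x] assms by auto
  next
    fix X assume "X \<in> insert (cl a \<union> cl b) ?R"
    then consider "X = cl a \<union> cl b" | x where "x \<in> S" "X = cl x" "X \<noteq> cl a" "X \<noteq> cl b"
      by auto
    then show "X \<in> cl' ` S"
    proof cases
      case 1
      then have "X = cl' a" using cl'[of a] eqv[of a a] assms(2) by auto
      then show ?thesis using assms(2) by blast
    next
      case 2
      then have "X = cl' x" using cl'[of x] eqv[of x] assms by auto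
      then show ?thesis using 2 by blast
    qed
  qed
  moreover have "cl a \<union> cl b \<notin> ?R"
  proof
    assume "cl a \<union> cl b \<in> ?R"
    then obtain z where "z \<in> S" "cl a \<union> cl b = cl z" by auto
    then have "a \<in> cl z" "b \<in> cl z" using eqv[of a a] eqv[of b b] assms by auto
    then show False using eqv \<open>z \<in> S\<close> assms by metis
  qed
  moreover have fin: "finite (cl ` S)" using assms by simp
  moreover have "card ?R + 2 = card (cl ` S)"
  proof -
    have sub: "{cl a, cl b} \<subseteq> cl ` S" using assms by auto
    then show ?thesis
      using card_Diff_subset[of "{cl a, cl b}" "cl ` S"] card_mono[OF fin sub] assms by simp
  qed
  ultimately show ?thesis by simp
qed

lemma card_orbs_swap_vals_merge:
  assumes "finite S" "bij_betw f S S" "a \<in> S" "b \<in> S" "b \<notin> orb f S a"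
  shows "card (orbs (swap_vals f a b) S) + 1 = card (orbs f S)"
  unfolding orbs_def
proof (rule card_merge_classes[of _ a b])
  show "x \<in> orb f S y \<longleftrightarrow> orb f S x = orb f S y" if "x \<in> S" "y \<in> S" for x y
    using orb_eq_iff[of S f y x] that assms by auto
  show "orb f S a \<noteq> orb f S b" using assms orb_refl[of b S f] by auto
qed (use assms orb_swap_vals_merge[OF assms] in auto)

text \<open>Let k be the first time f leads from a to b. After the swap, b is followed by f a, so
  the segment from f a to b closes up into a cycle, and by the choice of k this cycle avoids
  a.\<close>

lemma orb_swap_vals_split:
  assumes "finite S" "bij_betw f S S" "a \<in> S" "b \<in> S" "a \<noteq> b" "b \<in> orb f S a"
  shows "a \<notin> orb (swap_vals f a b) S b"
proof -
  let ?g = "swap_vals f a b"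
  have ex: "\<exists>n. (f ^^ n) a = b" using assms(6) by (auto simp: orb_def)
  define k where "k = (LEAST n. (f ^^ n) a = b)"
  have k: "(f ^^ k) a = b" unfolding k_def by (rule LeastI_ex[OF ex])
  have nb: "(f ^^ i) a \<noteq> b" if "i < k" for i using that not_less_Least unfolding k_def by blast
  have k0: "k > 0" using k assms(5) by (cases k) auto
  have na: "(f ^^ i) a \<noteq> a" if "0 < i" "i \<le> k" for i
  proof
    assume h: "(f ^^ i) a = a"
    have "(f ^^ (k - i)) ((f ^^ i) a) = (f ^^ k) a"
      using that by (metis funpow_add le_add_diff_inverse2 o_apply)
    then have "(f ^^ (k - i)) a = b" using h k by (simp only:)
    moreover have "k - i < k" using that by simp
    ultimately show False using nb by blast
  qed
  define C where "C = (\<lambda>i. (f ^^ i) a) ` {1..k}"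
  have "?g x \<in> C" if xC: "x \<in> C" for x
  proof -
    obtain i where i: "1 \<le> i" "i \<le> k" "x = (f ^^ i) a" using xC by (auto simp: C_def)
    show ?thesis
    proof (cases "i = k")
      case True
      then have "?g x = (f ^^ 1) a" using i k by (simp add: swap_vals_def)
      then show ?thesis using k0 unfolding C_def by (intro image_eqI[of _ _ 1]) auto
    next
      case False
      then have "?g x = (f ^^ Suc i) a" using i na[of i] nb[of i] by (simp add: swap_vals_def)
      then show ?thesis using i False unfolding C_def by (intro image_eqI[of _ _ "Suc i"]) auto
    qed
  qed
  moreover have "b \<in> C" using k k0 unfolding C_def by (intro image_eqI[of _ _ k]) auto
  ultimately have bC: "(?g ^^ n) b \<in> C" for n by (rule funpow_closed)
  have aC: "a \<notin> C"
  proof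
    assume "a \<in> C"
    then obtain i where "1 \<le> i" "i \<le> k" "a = (f ^^ i) a" unfolding C_def by (elim imageE) auto
    then show False using na[of i] by simp
  qed
  show ?thesis
  proof
    assume "a \<in> orb ?g S b"
    then obtain n where "(?g ^^ n) b = a" by (auto simp: orb_def)
    then show False using bC[of n] aC by simp
  qed
qed

text \<open>The swap is an involution, so splitting is merging read backwards.\<close>

lemma card_orbs_swap_vals_split:
  assumes "finite S" "bij_betw f S S" "a \<in> S" "b \<in> S" "a \<noteq> b" "b \<in> orb f S a"
  shows "card (orbs (swap_vals f a b) S) = card (orbs f S) + 1"
proof -
  let ?g = "swap_vals f a b"
  have bg: "bij_betw ?g S S" by (rule bij_swap_vals) (use assms in auto)
  have "b \<notin> orb ?g S a"
    using orb_swap_vals_split[OF assms] orb_sym[of S ?g a b] assms bg by blast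
  then show ?thesis
    using card_orbs_swap_vals_merge[of S ?g a b] bg assms by (simp add: swap_vals_involutive)
qed

section \<open>Components and face permutations\<close>

definition simple_graph :: "'a set set \<Rightarrow> bool" where
  "simple_graph E \<longleftrightarrow> finite E \<and> (\<forall>e\<in>E. card e = 2)"

definition component :: "'a set set \<Rightarrow> 'a \<Rightarrow> 'a set" where
  "component E v = {w. (adj E)\<^sup>*\<^sup>* v w}"

text \<open>The quantity whose half is minimised in \<open>genus\<close>, kept in the integers
  because it is not known in advance to be nonnegative.\<close>

definition euler_defect :: "'a set set \<Rightarrow> ('a \<times> 'a \<Rightarrow> 'a \<times> 'a) \<Rightarrow> int" where
  "euler_defect E \<sigma> = 2 * int (num_edge_components E) - int (card (\<Union>E)) + int (card E)
                  - int (num_faces E \<sigma>)"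

lemma num_edge_components_eq: "num_edge_components E = card (component E ` \<Union>E)"
  unfolding num_edge_components_def component_def by (rule arg_cong[of _ _ card]) auto

lemma num_faces_eq: "num_faces E \<sigma> = card (orbs (face_perm \<sigma>) (darts E))"
  unfolding num_faces_def orbs_def orb_def by (rule arg_cong[of _ _ card]) auto

lemma component_self: "v \<in> component E v"
  by (simp add: component_def)

lemma component_eq_iff: "x \<in> component E y \<longleftrightarrow> component E x = component E y"
proof -
  have "symp (adj E)" by (auto simp: symp_def adj_def insert_commute)
  then have "symp (adj E)\<^sup>*\<^sup>*" by (rule symp_rtranclp)
  then show ?thesis
    unfolding component_def by (auto dest: sympD intro: rtranclp_trans)
qed

lemma component_adj: "{u, v} \<in> E \<Longrightarrow> component E u = component E v"
  using component_eq_iff[of v E u] by (auto simp: component_def adj_def)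

text \<open>A vertex outside the graph counts as a singleton class, so inserting an edge with new
  endpoints can also be treated as a merging of two classes.\<close>

lemma component_isolated:
  assumes "v \<notin> \<Union>E"
  shows "component E v = {v}"
proof -
  have "w = v" if "(adj E)\<^sup>*\<^sup>* v w" for w
    using that by (induction rule: rtranclp_induct) (use assms in \<open>auto simp: adj_def\<close>)
  then show ?thesis by (auto simp: component_def)
qed

lemma component_invariant:
  assumes "\<And>a b. {a, b} \<in> E \<Longrightarrow> a \<in> U \<Longrightarrow> b \<in> U" "x \<in> U"
  shows "component E x \<subseteq> U"
proof -
  have "w \<in> U" if "(adj E)\<^sup>*\<^sup>* x w" for w
    using that by (induction rule: rtranclp_induct) (use assms in \<open>auto simp: adj_def\<close>)
  then show ?thesis by (auto simp: component_def)
qed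

lemma component_mono: "E \<subseteq> E' \<Longrightarrow> component E x \<subseteq> component E' x"
  unfolding component_def by (auto simp: adj_def elim!: rtranclp_mono[THEN predicate2D, rotated])

text \<open>The shape matches \<open>card_merge_classes\<close>. If u and v were already connected,
  the formula returns the old components.\<close>

lemma component_insert_edge:
  "component (insert {u, v} E) x =
    (if x \<in> component E u \<union> component E v then component E u \<union> component E v else component E x)"
proof -
  let ?E = "insert {u, v} E" and ?U = "component E u \<union> component E v"
  have cl: "b \<in> ?U" if "{a, b} \<in> ?E" "a \<in> ?U" for a b
    using that component_self[of u E] component_self[of v E] component_adj[of a b E] component_eq_iff[of _ E]
    by (auto simp: doubleton_eq_iff)
  show ?thesis
  proof (cases "x \<in> ?U")
    case True
    have "component ?E x \<subseteq> ?U" by (rule component_invariant) (use cl True in auto)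
    moreover have "component ?E u = component ?E v" by (rule component_adj) simp
    moreover have "?U \<subseteq> component ?E u \<union> component ?E v" using component_mono[of E ?E] by blast
    ultimately show ?thesis using True component_eq_iff[of x ?E u] by auto
  next
    case False
    have "component ?E x \<subseteq> {w. w \<in> component E x \<and> w \<notin> ?U}"
    proof (rule component_invariant)
      fix a b assume ab: "{a, b} \<in> ?E" "a \<in> {w. w \<in> component E x \<and> w \<notin> ?U}"
      have "{b, a} \<in> ?E" using ab by (simp add: insert_commute)
      then have "b \<notin> ?U" using cl[of b a] ab by auto
      moreover have "{a, b} \<in> E" using ab calculation component_self[of u E] component_self[of v E]
        by (auto simp: doubleton_eq_iff)
      ultimately show "b \<in> {w. w \<in> component E x \<and> w \<notin> ?U}"
        using ab component_adj[of a b E] component_eq_iff[of _ E x] by auto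
    qed (use False component_self in auto)
    then show ?thesis using component_mono[of E ?E x] False by auto
  qed
qed

lemma darts_insert: "darts (insert {u, v} E) = darts E \<union> {(u, v), (v, u)}"
  by (auto simp: darts_def doubleton_eq_iff)

lemma darts_swap: "prod.swap d \<in> darts E \<longleftrightarrow> d \<in> darts E"
  by (cases d) (simp add: darts_def insert_commute)

lemma darts_fst: "d \<in> darts E \<Longrightarrow> fst d \<in> \<Union>E" and darts_snd: "d \<in> darts E \<Longrightarrow> snd d \<in> \<Union>E"
  by (auto simp: darts_def)

lemma component_dart: "d \<in> darts E \<Longrightarrow> component E (fst d) = component E (snd d)"
  by (cases d) (simp add: darts_def component_adj)

lemma simple_graph_finite_Union: "simple_graph E \<Longrightarrow> finite (\<Union>E)"
  unfolding simple_graph_def by (metis card.infinite finite_Union zero_neq_numeral)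

lemma finite_darts: "simple_graph E \<Longrightarrow> finite (darts E)"
  by (rule finite_subset[of _ "\<Union>E \<times> \<Union>E"])
    (auto simp: darts_def simple_graph_finite_Union)

lemma dart_exists:
  assumes "simple_graph E" "u \<in> \<Union>E"
  obtains d where "d \<in> darts E" "fst d = u"
proof -
  obtain e where e: "e \<in> E" "u \<in> e" using assms by auto
  then obtain a b where "e = {a, b}" using assms by (auto simp: simple_graph_def card_2_iff)
  then have "(u, if u = a then b else a) \<in> darts E" using e by (auto simp: darts_def insert_commute)
  then show ?thesis using that by force
qed

lemma dart_neq: "simple_graph E \<Longrightarrow> (u, v) \<in> darts E \<Longrightarrow> u \<noteq> v"
  by (auto simp: darts_def simple_graph_def)

section \<open>Face permutations and the components they stay in\<close>

lemma face_perm_swap: "face_perm \<sigma> d = \<sigma> (prod.swap d)"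
  by (cases d) (simp add: face_perm_def)

lemma face_perm_swap_vals:
  "face_perm (swap_vals f a b) = swap_vals (face_perm f) (prod.swap a) (prod.swap b)"
proof
  fix d show "face_perm (swap_vals f a b) d = swap_vals (face_perm f) (prod.swap a) (prod.swap b) d"
    by (cases d; cases a; cases b) (simp add: face_perm_def swap_vals_def)
qed

lemma bij_face_perm:
  assumes "bij_betw \<sigma> (darts E) (darts E)"
  shows "bij_betw (face_perm \<sigma>) (darts E) (darts E)"
proof -
  have "bij_betw prod.swap (darts E) (darts E)"
    by (rule bij_betwI[where g = prod.swap]) (auto simp: darts_swap)
  then have "bij_betw (\<sigma> \<circ> prod.swap) (darts E) (darts E)" using assms by (rule bij_betw_trans)
  moreover have "\<sigma> \<circ> prod.swap = face_perm \<sigma>" by (auto simp: face_perm_def)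
  ultimately show ?thesis by simp
qed

lemma rotation_system_iff:
  "rotation_system E \<sigma> \<longleftrightarrow> bij_betw \<sigma> (darts E) (darts E) \<and>
     (\<forall>d\<in>darts E. fst (\<sigma> d) = fst d) \<and>
     (\<forall>d\<in>darts E. \<forall>d'\<in>darts E. fst d = fst d' \<longrightarrow> d' \<in> orb \<sigma> (darts E) d)"
  unfolding rotation_system_def orb_def by fastforce

text \<open>A face step crosses an edge and then rotates about the vertex reached, so it stays
  within one component.\<close>

lemma face_component:
  assumes "rotation_system E \<sigma>" "d \<in> darts E" "e \<in> orb (face_perm \<sigma>) (darts E) d"
  shows "component E (fst e) = component E (fst d)"
proof (rule orb_invariant[of "darts E" "face_perm \<sigma>" "\<lambda>d. component E (fst d)"])
  have rs: "bij_betw \<sigma> (darts E) (darts E)" "\<And>d. d \<in> darts E \<Longrightarrow> fst (\<sigma> d) = fst d"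
    using assms by (auto simp: rotation_system_def)
  show "face_perm \<sigma> x \<in> darts E" if "x \<in> darts E" for x
    using bij_face_perm[OF rs(1)] that by (auto simp: bij_betw_def)
  show "component E (fst (face_perm \<sigma> x)) = component E (fst x)" if "x \<in> darts E" for x
    using that rs(2)[of "prod.swap x"] component_dart[OF that] by (simp add: darts_swap face_perm_swap)
qed (use assms in auto)

text \<open>Sending a face to the component of any of its darts is well defined by
  \<open>face_component\<close>, and it is onto because every vertex of \<open>\<Union>E\<close> has
  an outgoing dart.\<close>

lemma num_faces_ge_components:
  assumes "simple_graph E" "rotation_system E \<sigma>"
  shows "num_edge_components E \<le> num_faces E \<sigma>"
proof -
  let ?O = "orb (face_perm \<sigma>) (darts E)"
  let ?h = "\<lambda>X. component E (fst (SOME d. d \<in> X))"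
  have "component E ` \<Union>E \<subseteq> ?h ` (orbs (face_perm \<sigma>) (darts E))"
  proof
    fix X assume "X \<in> component E ` \<Union>E"
    then obtain v where v: "v \<in> \<Union>E" "X = component E v" by blast
    obtain d where d: "d \<in> darts E" "fst d = v" using dart_exists[OF assms(1) v(1)] .
    have "(SOME e. e \<in> ?O d) \<in> ?O d" using orb_refl[OF d(1)] by (rule someI)
    then have "?h (?O d) = X" using face_component[OF assms(2) d(1)] d v by auto
    then show "X \<in> ?h ` (orbs (face_perm \<sigma>) (darts E))" using d by (auto simp: orbs_def)
  qed
  then show ?thesis
    unfolding num_edge_components_eq num_faces_eq
    using surj_card_le[of "orbs (face_perm \<sigma>) (darts E)" "component E ` \<Union>E" ?h] finite_darts[OF assms(1)]
    by (simp add: orbs_def)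
qed

section \<open>Inserting an edge into a rotation system\<close>

lemma swap_vals_fst:
  assumes "\<And>d. d \<in> T \<Longrightarrow> fst (\<tau> d) = fst d" "a \<in> T" "b \<in> T" "fst a = fst b" "d \<in> T"
  shows "fst (swap_vals \<tau> a b d) = fst d"
  using assms by (auto simp: swap_vals_def)

text \<open>The darts \<open>x\<close> and \<open>y\<close> of the new edge start as an extra face of length two, the rotation
  \<open>\<sigma>0\<close> fixing both. Inserting \<open>x\<close> after a dart \<open>a\<close> at \<open>u\<close> (giving \<open>\<sigma>1\<close>), and then \<open>y\<close> after a dart
  \<open>b\<close> at \<open>v\<close> (giving \<open>\<sigma>2\<close>), composes the face permutation with one transposition each, which merges
  two faces or splits one.\<close>
locale edge_extension =
  fixes E :: "'a set set" and u v :: 'a and \<sigma> :: "'a \<times> 'a \<Rightarrow> 'a \<times> 'a"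
  assumes sg: "simple_graph E" and new: "{u, v} \<notin> E" and uv: "u \<noteq> v" and rot: "rotation_system E \<sigma>"
begin

abbreviation "D \<equiv> darts E"
abbreviation "E' \<equiv> insert {u, v} E"
abbreviation "D' \<equiv> darts E'"
abbreviation "x \<equiv> (u, v)"
abbreviation "y \<equiv> (v, u)"

definition "\<sigma>0 = (\<lambda>d. if d \<in> D then \<sigma> d else d)"

lemma D'_eq: "D' = D \<union> {x, y}"
  by (rule darts_insert)

lemma xy_notin: "x \<notin> D" "y \<notin> D"
  using new by (auto simp: darts_def insert_commute)

lemma simple': "simple_graph E'"
  using sg uv by (auto simp: simple_graph_def)

lemma fin': "finite D'"
  by (rule finite_darts[OF simple'])

lemma \<sigma>_in: "d \<in> D \<Longrightarrow> \<sigma> d \<in> D"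
  using rot by (auto simp: rotation_system_def bij_betw_def)

lemma \<sigma>0_in: "d \<in> D' \<Longrightarrow> \<sigma>0 d \<in> D'"
  using \<sigma>_in by (auto simp: \<sigma>0_def D'_eq)

lemma bij_\<sigma>0: "bij_betw \<sigma>0 D' D'"
proof -
  have "inj_on \<sigma> D" using rot by (auto simp: rotation_system_def bij_betw_def)
  then have "inj_on \<sigma>0 D'"
    using \<sigma>_in unfolding inj_on_def \<sigma>0_def D'_eq by (metis Un_iff)
  moreover have "\<sigma>0 ` D' \<subseteq> D'" using \<sigma>0_in by auto
  ultimately show ?thesis using fin' by (simp add: bij_betw_def endo_inj_surj)
qed

lemma fst_\<sigma>0: "d \<in> D' \<Longrightarrow> fst (\<sigma>0 d) = fst d"
  using rot by (auto simp: rotation_system_def \<sigma>0_def)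

lemma orb_\<sigma>0: "d \<in> D \<Longrightarrow> d' \<in> D \<Longrightarrow> fst d = fst d' \<Longrightarrow> d' \<in> orb \<sigma>0 D' d"
proof -
  assume h: "d \<in> D" "d' \<in> D" "fst d = fst d'"
  have "orb \<sigma> D d = orb \<sigma>0 D' d"
    by (rule orb_cong) (use h \<sigma>_in in \<open>auto simp: \<sigma>0_def D'_eq\<close>)
  then show ?thesis using rot h by (auto simp: rotation_system_iff)
qed

lemma orb_\<sigma>0_D:
  assumes "d \<in> D"
  shows "orb \<sigma>0 D' d \<subseteq> D"
proof
  fix e assume e: "e \<in> orb \<sigma>0 D' d"
  have "(e \<in> D) = (d \<in> D)"
    by (rule orb_invariant[of D' \<sigma>0 "\<lambda>e. e \<in> D"])
      (use e assms \<sigma>0_in \<sigma>_in in \<open>auto simp: \<sigma>0_def D'_eq\<close>)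
  then show "e \<in> D" using assms by simp
qed

abbreviation "\<psi>0 \<equiv> face_perm \<sigma>0"

lemma bij_\<psi>0: "bij_betw \<psi>0 D' D'"
  by (rule bij_face_perm[OF bij_\<sigma>0])

lemma \<psi>0_xy: "\<psi>0 x = y" "\<psi>0 y = x"
  using xy_notin by (auto simp: face_perm_def \<sigma>0_def)

lemma \<psi>0_D: "d \<in> D \<Longrightarrow> \<psi>0 d = face_perm \<sigma> d"
  using darts_swap[of d E] by (simp add: face_perm_swap \<sigma>0_def)

lemma face_perm_in: "d \<in> D \<Longrightarrow> face_perm \<sigma> d \<in> D"
  using darts_swap[of d E] \<sigma>_in by (simp add: face_perm_swap)

lemma orb_\<psi>0_D: "d \<in> D \<Longrightarrow> orb \<psi>0 D' d = orb (face_perm \<sigma>) D d"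
  by (rule orb_cong[symmetric]) (use \<psi>0_D face_perm_in D'_eq in auto)

lemma orb_\<psi>0_xy: "orb \<psi>0 D' x = {x, y}" "orb \<psi>0 D' y = {x, y}"
proof -
  have c: "z \<in> {x, y} \<Longrightarrow> \<psi>0 z \<in> {x, y}" for z using \<psi>0_xy by auto
  have cl: "z \<in> D' \<Longrightarrow> \<psi>0 z \<in> D'" for z using bij_\<psi>0 by (auto simp: bij_betw_def)
  have "orb \<psi>0 D' z \<subseteq> {x, y}" if "z \<in> {x, y}" for z
    using funpow_closed[of "{x, y}" \<psi>0 z] c that unfolding orb_def by blast
  moreover have "{x, y} \<subseteq> orb \<psi>0 D' z" if "z \<in> {x, y}" for z
    using orb_step[of D' \<psi>0 z] orb_refl[of z D' \<psi>0] cl that \<psi>0_xy by (auto simp: D'_eq)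
  ultimately show "orb \<psi>0 D' x = {x, y}" "orb \<psi>0 D' y = {x, y}" by blast+
qed

lemma card_orbs_\<psi>0: "card (orbs \<psi>0 D') = num_faces E \<sigma> + 1"
proof -
  have "orbs \<psi>0 D' = insert {x, y} (orbs (face_perm \<sigma>) D)"
    unfolding orbs_def using orb_\<psi>0_D orb_\<psi>0_xy
    by (simp add: D'_eq image_Un insert_commute cong: image_cong)
  moreover have "{x, y} \<notin> orbs (face_perm \<sigma>) D"
    using xy_notin orb_subset[of "face_perm \<sigma>" D] by (auto simp: orbs_def)
  ultimately show ?thesis
    using finite_darts[OF sg] by (simp add: num_faces_eq orbs_def)
qed

text \<open>Cyclicity at every vertex is reduced to reachability in one direction: old orbits
  survive, and the new darts can be reached from the old ones with the same tail.
  \<open>orb_sym\<close> gives the converse, and x and y never share a tail since u and v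
  differ.\<close>

lemma rot_system':
  assumes "bij_betw \<tau> D' D'" "\<And>d. d \<in> D' \<Longrightarrow> fst (\<tau> d) = fst d"
    and old: "\<And>d. d \<in> D \<Longrightarrow> orb \<sigma>0 D' d \<subseteq> orb \<tau> D' d"
    and xu: "\<And>a. a \<in> D \<Longrightarrow> fst a = u \<Longrightarrow> x \<in> orb \<tau> D' a"
    and yv: "\<And>a. a \<in> D \<Longrightarrow> fst a = v \<Longrightarrow> y \<in> orb \<tau> D' a"
  shows "rotation_system E' \<tau>"
  unfolding rotation_system_iff
proof (intro conjI ballI impI)
  fix d d' assume d: "d \<in> D'" "d' \<in> D'" "fst d = fst d'"
  show "d' \<in> orb \<tau> D' d"
  proof (cases "d = d'")
    case True then show ?thesis using d orb_refl by metis
  next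
    case False
    then consider "d \<in> D" "d' \<in> D" | "d \<in> D" "d' \<in> {x, y}" | "d \<in> {x, y}" "d' \<in> D"
      using d uv by (auto simp: D'_eq)
    then show ?thesis
    proof cases
      case 1 then show ?thesis using orb_\<sigma>0 old d by blast
    next
      case 2 then show ?thesis using d xu[of d] yv[of d] by auto
    next
      case 3
      then have "d \<in> orb \<tau> D' d'" using d xu[of d'] yv[of d'] by auto
      then show ?thesis using orb_sym[of D' \<tau> d' d] fin' assms d by blast
    qed
  qed
qed (use assms in auto)

lemma card_E': "card E' = card E + 1"
  using sg new by (simp add: simple_graph_def)

lemma Union_E': "\<Union>E' = \<Union>E \<union> {u, v}"
  by auto

lemma fin_V': "finite (\<Union>E \<union> {u, v})"
  using simple_graph_finite_Union[OF sg] by simp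

lemma fin_V: "finite (\<Union>E)"
  using fin_V' by simp

text \<open>The right-hand side counts old components with endpoints not yet present added as
  singletons. The cases of an insertion that joins two components then differ only in the number of
  such singletons.\<close>

lemma card_merge_components:
  assumes "component E u \<noteq> component E v"
  shows "num_edge_components E' + 1 = card (component E ` (\<Union>E \<union> {u, v}))"
  unfolding num_edge_components_eq Union_E'
  by (rule card_merge_classes[OF fin_V' _ _ component_eq_iff assms component_insert_edge]) auto

lemma component_notin: "w \<notin> \<Union>E \<Longrightarrow> component E w \<notin> component E ` (\<Union>E)"
proof
  assume w: "w \<notin> \<Union>E" "component E w \<in> component E ` (\<Union>E)"
  then obtain z where "z \<in> \<Union>E" "z \<in> component E w" using component_self by fastforce
  then show False using w(1) component_isolated[OF w(1)] by auto
qed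

text \<open>A separate edge adds one component, two vertices, one edge and one face: 2 - 2 + 1 - 1 =
  0.\<close>

lemma extend_both_new:
  assumes "u \<notin> \<Union>E" "v \<notin> \<Union>E"
  shows "rotation_system E' \<sigma>0" "euler_defect E' \<sigma>0 = euler_defect E \<sigma>"
proof -
  show "rotation_system E' \<sigma>0"
  proof (rule rot_system')
    show "x \<in> orb \<sigma>0 D' a" if "a \<in> D" "fst a = u" for a
      using that assms darts_fst by metis
    show "y \<in> orb \<sigma>0 D' a" if "a \<in> D" "fst a = v" for a
      using that assms darts_fst by metis
  qed (use bij_\<sigma>0 fst_\<sigma>0 in simp_all)
  have ne: "component E u \<noteq> component E v"
    using assms component_isolated[of u E] component_isolated[of v E] uv by simp
  have "card (component E ` (\<Union>E \<union> {u, v})) = num_edge_components E + 2"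
    using ne component_notin assms fin_V by (simp add: num_edge_components_eq)
  then have "num_edge_components E' = num_edge_components E + 1"
    using card_merge_components[OF ne] by simp
  moreover have "card (\<Union>E') = card (\<Union>E) + 2"
    unfolding Union_E' using assms uv fin_V by simp
  moreover have "num_faces E' \<sigma>0 = num_faces E \<sigma> + 1"
    using card_orbs_\<psi>0 by (simp add: num_faces_eq)
  ultimately show "euler_defect E' \<sigma>0 = euler_defect E \<sigma>"
    using card_E' by (simp add: euler_defect_def)
qed

definition "\<sigma>1 a = swap_vals \<sigma>0 a x"

context
  fixes a
  assumes a: "a \<in> D" "fst a = u"
begin

lemma a_in: "a \<in> D'" "x \<in> D'" "y \<in> D'" "x \<notin> orb \<sigma>0 D' a"
  using a orb_\<sigma>0_D[OF a(1)] xy_notin by (auto simp: D'_eq)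

lemma bij_\<sigma>1: "bij_betw (\<sigma>1 a) D' D'"
  unfolding \<sigma>1_def by (rule bij_swap_vals[OF fin' bij_\<sigma>0]) (use a_in in auto)

lemma fst_\<sigma>1: "d \<in> D' \<Longrightarrow> fst (\<sigma>1 a d) = fst d"
  unfolding \<sigma>1_def by (rule swap_vals_fst[of D']) (use fst_\<sigma>0 a a_in in auto)

lemma orb_\<sigma>1:
  "d \<in> D' \<Longrightarrow> orb \<sigma>0 D' d \<subseteq> orb (\<sigma>1 a) D' d" "x \<in> orb (\<sigma>1 a) D' a"
proof -
  note merge = orb_swap_vals_merge[OF fin' bij_\<sigma>0 a_in(1,2,4)]
  show "orb \<sigma>0 D' d \<subseteq> orb (\<sigma>1 a) D' d" if "d \<in> D'"
    unfolding \<sigma>1_def merge[OF that]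
    using orb_trans[of d \<sigma>0 D' a] orb_trans[of d \<sigma>0 D' x] by auto
  show "x \<in> orb (\<sigma>1 a) D' a"
    unfolding \<sigma>1_def merge[OF a_in(1)] using orb_refl[of _ D' \<sigma>0] a_in by auto
qed

lemma face_\<sigma>1: "face_perm (\<sigma>1 a) = swap_vals \<psi>0 (prod.swap a) y"
  unfolding \<sigma>1_def face_perm_swap_vals by simp

lemma swap_a: "prod.swap a \<in> D" "prod.swap a \<in> D'" "y \<notin> orb \<psi>0 D' (prod.swap a)"
proof -
  show "prod.swap a \<in> D" using a darts_swap by blast
  then show "prod.swap a \<in> D'" "y \<notin> orb \<psi>0 D' (prod.swap a)"
    using orb_\<psi>0_D xy_notin orb_subset[of "face_perm \<sigma>" D "prod.swap a"] by (auto simp: D'_eq)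
qed

text \<open>The extra two-dart face {x, y} is absorbed by the face through the reverse of a, which
  cancels the + 1 of \<open>card_orbs_\<psi>0\<close>.\<close>

lemma num_faces_\<sigma>1: "card (orbs (face_perm (\<sigma>1 a)) D') = num_faces E \<sigma>"
  unfolding face_\<sigma>1
  using card_orbs_swap_vals_merge[OF fin' bij_\<psi>0 swap_a(2) a_in(3) swap_a(3)] card_orbs_\<psi>0
  by simp

text \<open>A pendant edge adds one vertex and one edge and leaves the numbers of components and
  faces unchanged.\<close>

lemma extend_one_new:
  assumes "v \<notin> \<Union>E"
  shows "rotation_system E' (\<sigma>1 a)" "euler_defect E' (\<sigma>1 a) = euler_defect E \<sigma>"
proof -
  show "rotation_system E' (\<sigma>1 a)"
  proof (rule rot_system')
    show "x \<in> orb (\<sigma>1 a) D' a'" if "a' \<in> D" "fst a' = u" for a'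
    proof -
      have "a \<in> orb (\<sigma>1 a) D' a'" using orb_\<sigma>0[of a' a] that a orb_\<sigma>1(1)[of a'] D'_eq by auto
      then show ?thesis using orb_\<sigma>1(2) orb_trans by fast
    qed
    show "y \<in> orb (\<sigma>1 a) D' b" if "b \<in> D" "fst b = v" for b
      using that assms darts_fst by metis
  next
    show "orb \<sigma>0 D' d \<subseteq> orb (\<sigma>1 a) D' d" if "d \<in> D" for d
      using orb_\<sigma>1(1)[of d] that D'_eq by simp
  qed (fact bij_\<sigma>1 fst_\<sigma>1)+
  have uV: "u \<in> \<Union>E" using a darts_fst by metis
  have ne: "component E u \<noteq> component E v"
    using component_notin[OF assms] uV by (metis imageI)
  have "card (component E ` (\<Union>E \<union> {u, v})) = num_edge_components E + 1"
    using uV component_notin assms fin_V by (simp add: num_edge_components_eq insert_absorb)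
  then have "num_edge_components E' = num_edge_components E"
    using card_merge_components[OF ne] by simp
  moreover have "card (\<Union>E') = card (\<Union>E) + 1"
    unfolding Union_E' using assms uV fin_V by (simp add: insert_absorb)
  moreover have "num_faces E' (\<sigma>1 a) = num_faces E \<sigma>"
    using num_faces_\<sigma>1 by (simp add: num_faces_eq)
  ultimately show "euler_defect E' (\<sigma>1 a) = euler_defect E \<sigma>"
    using card_E' by (simp add: euler_defect_def)
qed

context
  fixes b
  assumes b: "b \<in> D" "fst b = v"
begin

definition "\<sigma>2 = swap_vals (\<sigma>1 a) b y"

lemma b_in: "b \<in> D'" "y \<notin> orb (\<sigma>1 a) D' b"
proof -
  show bD: "b \<in> D'" using b by (simp add: D'_eq)
  \<comment> \<open>Orbits of \<open>\<sigma>0\<close> keep the tail, and b sits at v while a and x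
    sit at u. The first insertion therefore leaves the orbit of b unchanged.\<close>
  have "b \<notin> orb \<sigma>0 D' a \<union> orb \<sigma>0 D' x"
  proof -
    have "fst d = fst c" if "c \<in> D'" "d \<in> orb \<sigma>0 D' c" for c d
      using orb_invariant[of D' \<sigma>0 fst c d] that \<sigma>0_in fst_\<sigma>0 by blast
    then show ?thesis using a b uv a_in by fastforce
  qed
  then have "orb (\<sigma>1 a) D' b = orb \<sigma>0 D' b"
    unfolding \<sigma>1_def using orb_swap_vals_merge[OF fin' bij_\<sigma>0 a_in(1,2,4) bD] by simp
  then show "y \<notin> orb (\<sigma>1 a) D' b" using orb_\<sigma>0_D[OF b(1)] xy_notin by auto
qed

lemma rotation_\<sigma>2: "rotation_system E' \<sigma>2"
proof -
  note merge = orb_swap_vals_merge[OF fin' bij_\<sigma>1 b_in(1) a_in(3) b_in(2)]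
  have mono: "orb (\<sigma>1 a) D' d \<subseteq> orb \<sigma>2 D' d" if "d \<in> D'" for d
    unfolding \<sigma>2_def merge[OF that]
    using orb_trans[of d "\<sigma>1 a" D' b] orb_trans[of d "\<sigma>1 a" D' y] by auto
  have yb: "y \<in> orb \<sigma>2 D' b"
    unfolding \<sigma>2_def merge[OF b_in(1)] using orb_refl[of _ D' "\<sigma>1 a"] a_in b_in by auto
  have mono0: "orb \<sigma>0 D' d \<subseteq> orb \<sigma>2 D' d" if "d \<in> D'" for d
    using mono orb_\<sigma>1 that by blast
  show ?thesis
  proof (rule rot_system')
    show "bij_betw \<sigma>2 D' D'" 
      unfolding \<sigma>2_def by (rule bij_swap_vals[OF fin' bij_\<sigma>1]) (use a_in b_in in auto)
    show "fst (\<sigma>2 d) = fst d" if "d \<in> D'" for d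
      unfolding \<sigma>2_def by (rule swap_vals_fst[of D']) (use that fst_\<sigma>1 a_in b b_in in auto)
    show "x \<in> orb \<sigma>2 D' a'" if "a' \<in> D" "fst a' = u" for a'
    proof -
      have "a \<in> orb \<sigma>2 D' a'" using orb_\<sigma>0[of a' a] that a mono0[of a'] D'_eq by auto
      moreover have "x \<in> orb \<sigma>2 D' a" using orb_\<sigma>1(2) mono[OF a_in(1)] by blast
      ultimately show ?thesis using orb_trans by fast
    qed
    show "y \<in> orb \<sigma>2 D' b'" if "b' \<in> D" "fst b' = v" for b'
    proof -
      have "b \<in> orb \<sigma>2 D' b'" using orb_\<sigma>0[of b' b] that b mono0[of b'] D'_eq by auto
      then show ?thesis using yb orb_trans by fast
    qed
    show "orb \<sigma>0 D' d \<subseteq> orb \<sigma>2 D' d" if "d \<in> D" for d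
      using mono0[of d] that D'_eq by simp
  qed
qed

lemma swap_b: "prod.swap b \<in> D" "prod.swap b \<in> D'" "prod.swap b \<noteq> x"
proof -
  show "prod.swap b \<in> D" using b darts_swap by blast
  then show "prod.swap b \<in> D'" "prod.swap b \<noteq> x" using xy_notin D'_eq by auto
qed

lemma face_\<sigma>2: "face_perm \<sigma>2 = swap_vals (face_perm (\<sigma>1 a)) (prod.swap b) x"
  unfolding \<sigma>2_def face_perm_swap_vals by simp

lemma num_faces_\<sigma>2_merge:
  assumes "x \<notin> orb (face_perm (\<sigma>1 a)) D' (prod.swap b)"
  shows "num_faces E' \<sigma>2 + 1 = num_faces E \<sigma>"
  unfolding num_faces_eq[of E'] face_\<sigma>2
  using card_orbs_swap_vals_merge[OF fin' bij_face_perm[OF bij_\<sigma>1] swap_b(2) a_in(2) assms] num_faces_\<sigma>1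
  by simp

lemma num_faces_\<sigma>2_split:
  assumes "x \<in> orb (face_perm (\<sigma>1 a)) D' (prod.swap b)"
  shows "num_faces E' \<sigma>2 = num_faces E \<sigma> + 1"
  unfolding num_faces_eq[of E'] face_\<sigma>2
  using card_orbs_swap_vals_split[OF fin' bij_face_perm[OF bij_\<sigma>1] swap_b(2) a_in(2) swap_b(3) assms] num_faces_\<sigma>1
  by simp

text \<open>The face permutation of \<open>\<sigma>1 a\<close> preserves the old component of the tail of a dart, where both
  \<open>x\<close> and \<open>y\<close> are assigned the component of \<open>u\<close>.\<close>
lemma face_\<sigma>1_component:
  assumes "component E u \<noteq> component E v"
  shows "x \<notin> orb (face_perm (\<sigma>1 a)) D' (prod.swap b)"
proof
  let ?L = "\<lambda>d. if d \<in> D then component E (fst d) else component E u"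
  have L0: "?L (\<psi>0 d) = ?L d" if "d \<in> D'" for d
  proof (cases "d \<in> D")
    case True
    then have "\<psi>0 d \<in> orb (face_perm \<sigma>) D d"
      using orb_step[of D "face_perm \<sigma>" d] face_perm_in \<psi>0_D by simp
    then show ?thesis using face_component[OF rot True] True orb_subset by fastforce
  next
    case False
    then show ?thesis using that \<psi>0_xy xy_notin by (auto simp: D'_eq)
  qed
  \<comment> \<open>The transposition exchanges the images of \<open>prod.swap a\<close> and y.
    Since both carry the label of u, the labels stay invariant after it.\<close>
  have La: "?L (prod.swap a) = component E u"
    using swap_a(1) component_dart[OF a(1)] a by simp
  have cl: "d \<in> D' \<Longrightarrow> face_perm (\<sigma>1 a) d \<in> D'" for d
    using bij_face_perm[OF bij_\<sigma>1] by (auto simp: bij_betw_def)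
  assume h: "x \<in> orb (face_perm (\<sigma>1 a)) D' (prod.swap b)"
  have "?L x = ?L (prod.swap b)"
  proof (rule orb_invariant[OF cl _ swap_b(2) h])
    fix d assume d: "d \<in> D'"
    show "?L (face_perm (\<sigma>1 a) d) = ?L d"
      using L0[OF d] L0[OF a_in(3)] L0[OF swap_a(2)] La xy_notin
      by (auto simp: face_\<sigma>1 swap_vals_def)
  qed
  moreover have "?L (prod.swap b) = component E v"
    using swap_b(1) component_dart[OF b(1)] b by simp
  ultimately show False using assms xy_notin by simp
qed

text \<open>Within one component only the edge count and the face count change, the latter by 1
  either way, so the defect grows by 0 or 2. Between two components, one component and one face are
  lost and one edge is gained: - 2 + 1 + 1 = 0.\<close>

lemma extend_both_old:
  "euler_defect E' \<sigma>2 = euler_defect E \<sigma> \<or> euler_defect E' \<sigma>2 = euler_defect E \<sigma> + 2"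
proof -
  have V: "u \<in> \<Union>E" "v \<in> \<Union>E" using a b darts_fst by metis+
  then have VE: "\<Union>E \<union> {u, v} = \<Union>E" by blast
  have cV: "card (\<Union>E') = card (\<Union>E)" unfolding Union_E' VE ..
  show ?thesis
  proof (cases "component E u = component E v")
    case True
    then have "component E' w = component E w" for w
      using component_insert_edge[of u v E w] component_eq_iff[of w E] by auto
    then have "num_edge_components E' = num_edge_components E"
      unfolding num_edge_components_eq Union_E' VE by simp
    moreover have "num_faces E' \<sigma>2 + 1 = num_faces E \<sigma> \<or> num_faces E' \<sigma>2 = num_faces E \<sigma> + 1"
      using num_faces_\<sigma>2_merge num_faces_\<sigma>2_split by blast
    ultimately show ?thesis using cV card_E' by (auto simp: euler_defect_def)
  next
    case False
    have "num_edge_components E' + 1 = num_edge_components E"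
      using card_merge_components[OF False] unfolding VE by (simp add: num_edge_components_eq)
    moreover have "num_faces E' \<sigma>2 + 1 = num_faces E \<sigma>"
      by (rule num_faces_\<sigma>2_merge[OF face_\<sigma>1_component[OF False]])
    ultimately show ?thesis using cV card_E' by (simp add: euler_defect_def)
  qed
qed

end

end

end

section \<open>A rotation system attaining the genus\<close>

lemma extend_edge:
  assumes "simple_graph E" "{u, v} \<notin> E" "u \<noteq> v" "rotation_system E \<sigma>"
  shows "\<exists>\<tau>. rotation_system (insert {u, v} E) \<tau> \<and>
    (euler_defect (insert {u, v} E) \<tau> = euler_defect E \<sigma> \<or>
     euler_defect (insert {u, v} E) \<tau> = euler_defect E \<sigma> + 2)"
proof -
  \<comment> \<open>\<open>extend_one_new\<close> expects the old endpoint first; stated for s and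
    t, the case can be used with u and v in either order.\<close>
  have one: "\<exists>\<tau>. rotation_system (insert {s, t} E) \<tau> \<and> euler_defect (insert {s, t} E) \<tau> = euler_defect E \<sigma>"
    if st: "s \<in> \<Union>E" "t \<notin> \<Union>E" "{s, t} = {u, v}" for s t
  proof -
    interpret edge_extension E s t \<sigma>
    proof unfold_locales
      show "{s, t} \<notin> E" using assms(2) st(3) by simp
      show "s \<noteq> t" using st(1,2) by blast
    qed (fact assms)+
    obtain a where "a \<in> darts E" "fst a = s" using dart_exists[OF assms(1) st(1)] .
    then show ?thesis using extend_one_new st by blast
  qed
  interpret edge_extension E u v \<sigma> using assms by unfold_locales
  consider "u \<notin> \<Union>E" "v \<notin> \<Union>E" | "u \<in> \<Union>E" "v \<notin> \<Union>E" | "v \<in> \<Union>E" "u \<notin> \<Union>E"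
    | "u \<in> \<Union>E" "v \<in> \<Union>E" by blast
  then show ?thesis
  proof cases
    case 1 then show ?thesis using extend_both_new by blast
  next
    case 2 then show ?thesis using one[of u v] by blast
  next
    case 3 then show ?thesis using one[of v u] by (auto simp: insert_commute)
  next
    case 4
    obtain a where a: "a \<in> darts E" "fst a = u" using dart_exists[OF assms(1) 4(1)] .
    obtain b where b: "b \<in> darts E" "fst b = v" using dart_exists[OF assms(1) 4(2)] .
    show ?thesis using rotation_\<sigma>2[OF a b] extend_both_old[OF a b] by blast
  qed
qed

text \<open>Parity and nonnegativity come from the construction: the empty graph has defect 0 and
  every insertion adds 0 or 2. This makes the set under the LEAST in \<open>genus\<close>
  nonempty.\<close>

lemma exists_genus_rotation:
  assumes "simple_graph E"
  shows "\<exists>\<sigma> g. rotation_system E \<sigma> \<and> 2 * int g = euler_defect E \<sigma>"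
proof -
  have "finite E" using assms by (simp add: simple_graph_def)
  then show ?thesis using assms
  proof (induction E rule: finite_induct)
    case empty
    have "rotation_system ({} :: 'a set set) id" 
      by (simp add: rotation_system_def darts_def)
    moreover have "euler_defect ({} :: 'a set set) id = 0"
      by (simp add: euler_defect_def num_edge_components_eq num_faces_eq orbs_def darts_def)
    ultimately show ?case by (metis mult_zero_right of_nat_0)
  next
    case (insert e E)
    have sg: "simple_graph E" and "card e = 2" using insert.prems by (auto simp: simple_graph_def)
    then obtain u v where e: "e = {u, v}" "u \<noteq> v" by (auto simp: card_2_iff)
    obtain \<sigma> g where \<sigma>: "rotation_system E \<sigma>" "2 * int g = euler_defect E \<sigma>"
      using insert.IH sg by blast
    obtain \<tau> where \<tau>: "rotation_system (insert e E) \<tau>"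
      "euler_defect (insert e E) \<tau> = 2 * int g \<or> euler_defect (insert e E) \<tau> = 2 * int (g + 1)"
      using extend_edge[of E u v \<sigma>] sg insert.hyps e \<sigma> by auto
    then show ?case by metis
  qed
qed

lemma genus_rotation:
  assumes "simple_graph E"
  obtains \<sigma> where "rotation_system E \<sigma>" "2 * int (genus E) = euler_defect E \<sigma>"
proof -
  have "\<exists>g \<sigma>. rotation_system E \<sigma> \<and> 2 * int g = euler_defect E \<sigma>"
    using exists_genus_rotation[OF assms] by blast
  then have "\<exists>\<sigma>. rotation_system E \<sigma> \<and> 2 * int (genus E) = euler_defect E \<sigma>"
    unfolding genus_def euler_defect_def by (rule LeastI_ex)
  then show ?thesis using that by blast
qed

section \<open>Bounds on the number of faces\<close>

text \<open>A cycle is listed once for every starting vertex and direction. The first two entries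
  thus name a dart, from which a face can be recovered, and the overcounting only weakens an upper
  bound.\<close>

definition short_cycles :: "'a set set \<Rightarrow> nat \<Rightarrow> 'a list set" where
  "short_cycles E K = {xs. 3 \<le> length xs \<and> length xs \<le> K \<and> distinct xs \<and>
     (\<forall>i<length xs. {xs ! i, xs ! (Suc i mod length xs)} \<in> E)}"

lemma short_cycles_subset: "short_cycles E K \<subseteq> {xs. set xs \<subseteq> \<Union>E \<and> length xs \<le> K}"
proof
  fix xs assume xs: "xs \<in> short_cycles E K"
  have "xs ! i \<in> \<Union>E" if "i < length xs" for i
    using xs that unfolding short_cycles_def by blast
  then show "xs \<in> {xs. set xs \<subseteq> \<Union>E \<and> length xs \<le> K}"
    using xs by (auto simp: short_cycles_def in_set_conv_nth)
qed

lemma finite_short_cycles: "simple_graph E \<Longrightarrow> finite (short_cycles E K)"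
  by (rule finite_subset[OF short_cycles_subset])
    (simp add: finite_lists_length_le simple_graph_finite_Union)

lemma card_darts_le:
  assumes "simple_graph E"
  shows "card (darts E) \<le> 2 * card E"
proof -
  have fin: "finite E" using assms by (simp add: simple_graph_def)
  have "card {d. {fst d, snd d} = e} \<le> 2" if eE: "e \<in> E" for e
  proof -
    have "card e = 2" using eE assms by (simp add: simple_graph_def)
    then obtain a b where "e = {a, b}" by (auto simp: card_2_iff)
    then have "{d. {fst d, snd d} = e} \<subseteq> {(a, b), (b, a)}" by (auto simp: doubleton_eq_iff)
    then have "card {d. {fst d, snd d} = e} \<le> card {(a, b), (b, a)}" by (intro card_mono) auto
    then show ?thesis by (simp add: card_insert_if split: if_splits)
  qed
  then have "card (\<Union>e\<in>E. {d. {fst d, snd d} = e}) \<le> (\<Sum>e\<in>E. 2)"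
    by (intro order_trans[OF card_UN_le[OF fin]] sum_mono) auto
  moreover have "darts E = (\<Union>e\<in>E. {d. {fst d, snd d} = e})" by (auto simp: darts_def)
  ultimately show ?thesis by simp
qed

text \<open>Distinct orbits are disjoint, and each long one uses up at least K + 1 elements of
  S.\<close>

lemma card_long_orbs:
  assumes "finite S" "bij_betw f S S"
  shows "(K + 1) * card {X \<in> orbs f S. K < card X} \<le> card S"
proof -
  let ?L = "{X \<in> orbs f S. K < card X}"
  have fin: "finite ?L" using assms by (simp add: orbs_def)
  have "(K + 1) * card ?L = (\<Sum>X\<in>?L. K + 1)" by simp
  also have "\<dots> \<le> (\<Sum>X\<in>?L. card X)" by (rule sum_mono) auto
  also have "\<dots> = card (\<Union>?L)"
  proof (rule card_Union_disjoint[symmetric])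
    show "pairwise disjnt ?L"
    proof (rule pairwiseI)
      fix X Y assume XY: "X \<in> ?L" "Y \<in> ?L" "X \<noteq> Y"
      then obtain x y where xy: "x \<in> S" "y \<in> S" "X = orb f S x" "Y = orb f S y" by (auto simp: orbs_def)
      show "disjnt X Y"
      proof (rule ccontr)
        assume "\<not> disjnt X Y"
        then obtain z where "z \<in> X" "z \<in> Y" by (auto simp: disjnt_def)
        then show False using xy XY orb_eq[OF assms, of x z] orb_eq[OF assms, of y z] by simp
      qed
    qed
    show "finite X" if "X \<in> ?L" for X using that card_ge_0_finite[of X] by simp
  qed
  also have "\<dots> \<le> card S"
    using assms(1) orb_subset[of f S] by (intro card_mono) (auto simp: orbs_def)
  finally show ?thesis .
qed

text \<open>If the face turns back after d, then \<sigma> fixes the reverse of d. As \<sigma> is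
  cyclic at each vertex, the head of d has degree one, so d and with it the face are determined by
  that vertex.\<close>

lemma card_backtracking_faces:
  assumes "simple_graph E" "rotation_system E \<sigma>"
  shows "card {X \<in> orbs (face_perm \<sigma>) (darts E). \<exists>d\<in>X. face_perm \<sigma> d = prod.swap d} \<le> card (\<Union>E)"
proof -
  let ?D = "darts E" and ?f = "face_perm \<sigma>"
  let ?B = "{X \<in> orbs ?f ?D. \<exists>d\<in>X. ?f d = prod.swap d}"
  let ?h = "\<lambda>v. orb ?f ?D (SOME d. d \<in> ?D \<and> snd d = v)"
  have bf: "bij_betw ?f ?D ?D" using assms(2) by (simp add: rotation_system_def bij_face_perm)
  have "?B \<subseteq> ?h ` \<Union>E"
  proof
    fix X assume "X \<in> ?B"
    then obtain c d where d: "c \<in> ?D" "X = orb ?f ?D c" "d \<in> X" "?f d = prod.swap d"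
      by (auto simp: orbs_def)
    have dD: "d \<in> ?D" using d orb_subset by fast
    have X: "X = orb ?f ?D d" using orb_eq[OF finite_darts[OF assms(1)] bf] d by metis
    have fix_d: "\<sigma> (prod.swap d) = prod.swap d" using d by (simp add: face_perm_swap)
    have "(\<sigma> ^^ n) (prod.swap d) = prod.swap d" for n
      by (induction n) (simp_all add: fix_d)
    then have "orb \<sigma> ?D (prod.swap d) \<subseteq> {prod.swap d}" by (auto simp: orb_def)
    then have uniq: "e = d" if "e \<in> ?D" "snd e = snd d" for e
    proof -
      have "prod.swap e \<in> orb \<sigma> ?D (prod.swap d)"
        using assms(2) that dD darts_swap[of e E] darts_swap[of d E] by (simp add: rotation_system_iff)
      then have "prod.swap e = prod.swap d" using \<open>orb \<sigma> ?D (prod.swap d) \<subseteq> {prod.swap d}\<close> by blast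
      then show ?thesis by (metis swap_swap)
    qed
    have "(SOME e. e \<in> ?D \<and> snd e = snd d) = d"
      by (rule some_equality) (use dD uniq in auto)
    then have "X = ?h (snd d)" using X by simp
    then show "X \<in> ?h ` \<Union>E" using darts_snd[OF dD] by blast
  qed
  then show ?thesis
    using surj_card_le simple_graph_finite_Union[OF assms(1)] by blast
qed

text \<open>A facial walk may repeat vertices, so a shortest closed subwalk is taken. It is a
  genuine cycle, and since it starts along a dart of X, that dart recovers the whole face; different
  faces thus get different cycles.\<close>

lemma short_face_cycle:
  assumes "simple_graph E" "rotation_system E \<sigma>"
    and X: "X \<in> orbs (face_perm \<sigma>) (darts E)" "card X \<le> K"
    and nb: "\<And>d. d \<in> X \<Longrightarrow> face_perm \<sigma> d \<noteq> prod.swap d"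
  obtains xs where "xs \<in> short_cycles E K" "X = orb (face_perm \<sigma>) (darts E) (xs ! 0, xs ! 1)"
proof -
  let ?D = "darts E" and ?f = "face_perm \<sigma>"
  have fin: "finite ?D" by (rule finite_darts[OF assms(1)])
  have bf: "bij_betw ?f ?D ?D" using assms(2) by (simp add: rotation_system_def bij_face_perm)
  have XD: "X \<subseteq> ?D" using X(1) orb_subset[of ?f ?D] by (auto simp: orbs_def)
  obtain c where c: "c \<in> ?D" "X = orb ?f ?D c" using X(1) by (auto simp: orbs_def)
  have Xeq: "X = orb ?f ?D d" if "d \<in> X" for d
    using orb_eq[OF fin bf c(1), of d] that c(2) by simp
  have Xf: "?f d \<in> X" if "d \<in> X" for d
    using orb_step[of ?D ?f d] bf XD Xeq[OF that] that by (auto simp: bij_betw_def)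
  have Xn: "(?f ^^ n) d \<in> X" if "d \<in> X" for n d
    using funpow_closed[of X ?f d n] Xf that by blast
  have snd_fst: "fst (?f d) = snd d" if "d \<in> X" for d
    using assms(2) darts_swap[of d E] XD that by (auto simp: rotation_system_def face_perm_swap)
  obtain d0 where d0: "d0 \<in> X" using X(1) orb_refl[of _ ?D ?f] by (auto simp: orbs_def)
  \<comment> \<open>The starting dart ranges over all of X. A repeated vertex inside a shortest
    return would therefore itself be a shorter return.\<close>
  define P where "P l \<longleftrightarrow> 1 \<le> l \<and> (\<exists>d\<in>X. fst ((?f ^^ l) d) = fst d)" for l
  obtain m where m: "m \<le> K" "P m"
  proof -
    \<comment> \<open>The iterates with index 0 up to \<open>card X\<close> are one too many to be
      distinct in X, so some dart recurs within K steps.\<close>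
    have "card ((\<lambda>i. (?f ^^ i) d0) ` {..card X}) \<le> card X"
      by (rule card_mono[OF finite_subset[OF XD fin]]) (use Xn[OF d0] in blast)
    then have "\<not> inj_on (\<lambda>i. (?f ^^ i) d0) {..card X}" by (intro pigeonhole) simp
    then obtain i j where "i \<le> card X" "j \<le> card X" "i \<noteq> j" "(?f ^^ i) d0 = (?f ^^ j) d0"
      by (auto simp: inj_on_def)
    then obtain i j where ij: "j \<le> card X" "i < j" "(?f ^^ i) d0 = (?f ^^ j) d0"
      by (metis nat_neq_iff)
    have "(?f ^^ (j - i)) ((?f ^^ i) d0) = (?f ^^ j) d0"
      using ij by (metis funpow_add le_add_diff_inverse2 less_imp_le o_apply)
    then have "P (j - i)"
      unfolding P_def using ij Xn[OF d0, of i] by (intro conjI bexI[of _ "(?f ^^ i) d0"]) auto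
    then show thesis using that[of "j - i"] ij X(2) by simp
  qed
  define l where "l = (LEAST l. P l)"
  have Pl: "P l" unfolding l_def using m(2) by (rule LeastI)
  have lm: "l \<le> K" unfolding l_def using Least_le[of P, OF m(2)] m(1) by simp
  have least: "\<not> P i" if "i < l" for i using that not_less_Least unfolding l_def by blast
  obtain d where d: "d \<in> X" "fst ((?f ^^ l) d) = fst d" and l1: "1 \<le> l" using Pl by (auto simp: P_def)
  have dn: "fst e \<noteq> snd e" if "e \<in> X" for e
    using dart_neq[OF assms(1), of "fst e" "snd e"] XD that by auto
  \<comment> \<open>Length 1 would be a loop, and length 2 would be a backtracking, which
    \<open>nb\<close> forbids.\<close>
  have "l \<noteq> 1" using d snd_fst[OF d(1)] dn[OF d(1)] by auto
  moreover have "l \<noteq> 2"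
  proof
    assume "l = 2"
    then have "fst (?f (?f d)) = fst d" using d by (simp add: numeral_2_eq_2)
    then have "snd (?f d) = fst d" using snd_fst[OF Xf[OF d(1)]] by simp
    then have "?f d = prod.swap d" using snd_fst[OF d(1)] by (simp add: prod_eq_iff)
    then show False using nb d by blast
  qed
  ultimately have l3: "3 \<le> l" using l1 by simp
  define xs where "xs = map (\<lambda>i. fst ((?f ^^ i) d)) [0..<l]"
  have len: "length xs = l" and nth: "i < l \<Longrightarrow> xs ! i = fst ((?f ^^ i) d)" for i
    by (simp_all add: xs_def)
  have ne: "fst ((?f ^^ i) d) \<noteq> fst ((?f ^^ j) d)" if "i < j" "j < l" for i j
  proof
    assume h: "fst ((?f ^^ i) d) = fst ((?f ^^ j) d)"
    have "(?f ^^ (j - i)) ((?f ^^ i) d) = (?f ^^ j) d"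
      using that by (metis funpow_add le_add_diff_inverse2 less_imp_le o_apply)
    then have "P (j - i)" unfolding P_def
      using h that Xn[OF d(1), of i] by (intro conjI bexI[of _ "(?f ^^ i) d"]) auto
    then show False using least[of "j - i"] that l1 by simp
  qed
  have "distinct xs"
    unfolding distinct_conv_nth len using ne nth by (metis linorder_neqE_nat)
  moreover have "{xs ! i, xs ! (Suc i mod l)} \<in> E" if "i < l" for i
  proof -
    have "xs ! (Suc i mod l) = fst ((?f ^^ Suc i) d)"
    proof (cases "Suc i = l")
      case True
      then have "xs ! (Suc i mod l) = fst d" using nth[of 0] l1 by simp
      then show ?thesis using True d(2) by simp
    next
      case False
      then show ?thesis using nth[of "Suc i"] that by simp
    qed
    then have "xs ! (Suc i mod l) = snd ((?f ^^ i) d)" using snd_fst[OF Xn[OF d(1)]] by simp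
    moreover have "(?f ^^ i) d \<in> ?D" using Xn[OF d(1)] XD by blast
    ultimately show ?thesis using nth[OF that] by (auto simp: darts_def)
  qed
  ultimately have "xs \<in> short_cycles E K" using l3 lm len by (simp add: short_cycles_def)
  moreover have "(xs ! 0, xs ! 1) = d"
    using nth[of 0] nth[of 1] l3 snd_fst[OF d(1)] by (simp add: prod_eq_iff)
  ultimately show ?thesis using that Xeq[OF d(1)] by simp
qed

text \<open>Every face is long, backtracking or carries a short cycle; these classes may overlap.
  Multiplying by K + 1 avoids division of natural numbers.\<close>

lemma num_faces_le:
  assumes "simple_graph E" "rotation_system E \<sigma>"
  shows "(K + 1) * num_faces E \<sigma> \<le> 2 * card E + (K + 1) * (card (\<Union>E) + card (short_cycles E K))"
proof -
  let ?D = "darts E" and ?f = "face_perm \<sigma>"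
  let ?O = "orbs ?f ?D"
  let ?L = "{X \<in> ?O. K < card X}"
  let ?B = "{X \<in> ?O. \<exists>d\<in>X. ?f d = prod.swap d}"
  let ?S = "(\<lambda>xs. orb ?f ?D (xs ! 0, xs ! 1)) ` short_cycles E K"
  have bf: "bij_betw ?f ?D ?D" using assms(2) by (simp add: rotation_system_def bij_face_perm)
  have fO: "finite ?O" using finite_darts[OF assms(1)] by (simp add: orbs_def)
  have "?O \<subseteq> ?L \<union> ?B \<union> ?S"
  proof
    fix X assume X: "X \<in> ?O"
    show "X \<in> ?L \<union> ?B \<union> ?S"
    proof (cases "X \<in> ?L \<or> X \<in> ?B")
      case False
      then show ?thesis using short_face_cycle[OF assms X, of K] X by (metis (mono_tags, lifting) CollectI UnI2 image_eqI not_less)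
    qed auto
  qed
  then have "card ?O \<le> card (?L \<union> ?B \<union> ?S)"
    using fO finite_short_cycles[OF assms(1)] by (intro card_mono) auto
  also have "\<dots> \<le> card ?L + card ?B + card ?S"
    by (intro order_trans[OF card_Un_le] add_right_mono card_Un_le)
  also have "\<dots> \<le> card ?L + (card (\<Union>E) + card (short_cycles E K))"
  proof -
    have "card ?S \<le> card (short_cycles E K)"
      by (rule card_image_le[OF finite_short_cycles[OF assms(1)]])
    then show ?thesis using card_backtracking_faces[OF assms] by linarith
  qed
  finally have "card ?O \<le> card ?L + (card (\<Union>E) + card (short_cycles E K))" .
  from mult_le_mono2[OF this, of "K + 1"] have "(K + 1) * num_faces E \<sigma> \<le> (K + 1) * card ?L + (K + 1) * (card (\<Union>E) + card (short_cycles E K))"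
    unfolding num_faces_eq by (simp only: add_mult_distrib2)
  moreover have "(K + 1) * card ?L \<le> 2 * card E"
    using card_long_orbs[OF finite_darts[OF assms(1)] bf, of K] card_darts_le[OF assms(1)] by linarith
  ultimately show ?thesis by linarith
qed

text \<open>The vertex count enters twice, from Euler's formula and from the backtracking faces; the
  term 2 c is dropped as nonnegative.\<close>

lemma genus_lower:
  assumes "simple_graph E"
  shows "real (card E) * (1 - 2 / (real K + 1)) - 2 * real (card (\<Union>E)) - real (card (short_cycles E K))
    \<le> 2 * real (genus E)"
proof -
  obtain \<sigma> where \<sigma>: "rotation_system E \<sigma>" "2 * int (genus E) = euler_defect E \<sigma>"
    using genus_rotation[OF assms] .
  have "real_of_int (2 * int (genus E)) = real_of_int (euler_defect E \<sigma>)" using \<sigma>(2) by simp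
  then have "2 * real (genus E) \<ge> real (card E) - real (card (\<Union>E)) - real (num_faces E \<sigma>)"
    by (simp add: euler_defect_def)
  moreover have "real (num_faces E \<sigma>) \<le> 2 * real (card E) / (real K + 1)
      + (real (card (\<Union>E)) + real (card (short_cycles E K)))"
  proof -
    have "real ((K + 1) * num_faces E \<sigma>) \<le> real (2 * card E + (K + 1) * (card (\<Union>E) + card (short_cycles E K)))"
      using num_faces_le[OF assms \<sigma>(1)] of_nat_le_iff by blast
    then show ?thesis by (simp add: field_simps)
  qed
  ultimately show ?thesis by (simp add: algebra_simps)
qed

section \<open>Bipartite graphs and the upper bound on the genus\<close>

lemma bip_edges_image: "bip_edges S = (\<lambda>(i, j). {Inl i, Inr j}) ` S"
  by (auto simp: bip_edges_def)

lemma inj_bip_edge: "inj_on (\<lambda>(i, j). {Inl i, Inr j}) S"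
  by (auto simp: inj_on_def doubleton_eq_iff)

lemma card_bip_edges: "card (bip_edges S) = card S"
  unfolding bip_edges_image by (rule card_image[OF inj_bip_edge])

lemma simple_graph_bip_edges: "finite S \<Longrightarrow> simple_graph (bip_edges S)"
  by (auto simp: simple_graph_def bip_edges_image)

lemma Union_bip_edges: "\<Union>(bip_edges S) = Inl ` fst ` S \<union> Inr ` snd ` S"
  by (force simp: bip_edges_image)

lemma card_Union_bip_edges:
  assumes "finite S"
  shows "card (\<Union>(bip_edges S)) = card (fst ` S) + card (snd ` S)"
proof -
  have "card (\<Union>(bip_edges S)) = card (Inl ` fst ` S :: (nat + nat) set) + card (Inr ` snd ` S :: (nat + nat) set)"
    unfolding Union_bip_edges by (rule card_Un_disjoint) (use assms in auto)
  then show ?thesis by (simp add: card_image)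
qed

lemma genus_bip_upper:
  assumes "finite S"
  shows "2 * genus (bip_edges S) + card (fst ` S) \<le> card S"
proof -
  let ?E = "bip_edges S"
  note sg = simple_graph_bip_edges[OF assms]
  obtain \<sigma> where \<sigma>: "rotation_system ?E \<sigma>" "2 * int (genus ?E) = euler_defect ?E \<sigma>"
    using genus_rotation[OF sg] .
  have "component ?E ` \<Union>?E \<subseteq> (\<lambda>j. component ?E (Inr j)) ` snd ` S"
  proof
    fix X assume "X \<in> component ?E ` \<Union>?E"
    then obtain i j where ij: "(i, j) \<in> S" "X = component ?E (Inl i) \<or> X = component ?E (Inr j)"
      by (auto simp: Union_bip_edges)
    moreover have "component ?E (Inl i) = component ?E (Inr j)"
      by (rule component_adj) (use ij in \<open>auto simp: bip_edges_def\<close>)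
    ultimately show "X \<in> (\<lambda>j. component ?E (Inr j)) ` snd ` S" by force
  qed
  then have "num_edge_components ?E \<le> card (snd ` S)"
    unfolding num_edge_components_eq using assms by (simp add: surj_card_le)
  then show ?thesis
    using \<sigma>(2) num_faces_ge_components[OF sg \<sigma>(1)] card_Union_bip_edges[OF assms]
    by (simp add: euler_defect_def card_bip_edges)
qed

section \<open>Random subsets\<close>

text \<open>A finite weighted sum in place of a probability space: linearity is algebra of sums, and
  only monotonicity asks for p between 0 and 1.\<close>

definition expect :: "'a set \<Rightarrow> real \<Rightarrow> ('a set \<Rightarrow> real) \<Rightarrow> real" where
  "expect A p f = (\<Sum>S\<in>Pow A. p ^ card S * (1 - p) ^ (card A - card S) * f S)"

lemma expect_add: "expect A p (\<lambda>S. f S + g S) = expect A p f + expect A p g"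
  by (simp add: expect_def distrib_left sum.distrib)

lemma expect_cmult: "expect A p (\<lambda>S. c * f S) = c * expect A p f"
  by (simp add: expect_def sum_distrib_left mult.left_commute)

lemma expect_sum: "expect A p (\<lambda>S. \<Sum>i\<in>I. f i S) = (\<Sum>i\<in>I. expect A p (f i))"
  unfolding expect_def by (subst sum.swap) (simp add: sum_distrib_left)

lemma expect_mono:
  assumes "0 \<le> p" "p \<le> 1" "\<And>S. S \<subseteq> A \<Longrightarrow> f S \<le> g S"
  shows "expect A p f \<le> expect A p g"
  unfolding expect_def using assms by (intro sum_mono mult_left_mono) auto

lemma expect_cong: "(\<And>S. S \<subseteq> A \<Longrightarrow> f S = g S) \<Longrightarrow> expect A p f = expect A p g"
  unfolding expect_def by (rule sum.cong) auto

lemma prod_if_subset: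
  fixes c d :: real
  assumes "finite A" "T \<subseteq> A"
  shows "(\<Prod>a\<in>A. if a \<in> T then c else d) = c ^ card T * d ^ card (A - T)"
proof -
  have "(\<Prod>a\<in>A. if a \<in> T then c else d) = (\<Prod>a\<in>A \<inter> T. c) * (\<Prod>a\<in>A - T. d)"
    using prod.If_cases[OF assms(1), of "\<lambda>a. a \<in> T" "\<lambda>_. c" "\<lambda>_. d"]
    by (simp add: Int_def Diff_eq)
  then show ?thesis using assms(2) by (simp add: Int_absorb1)
qed

text \<open>\<open>prod_add\<close> expands a product of sums over A into a sum over subsets S, with
  one summand chosen on S and the other off S. Putting 0 in place of 1 - p on T removes exactly the
  S that do not contain T.\<close>

lemma expect_superset:
  assumes "finite A" "T \<subseteq> A"
  shows "expect A p (\<lambda>S. of_bool (T \<subseteq> S)) = p ^ card T"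
proof -
  let ?g = "\<lambda>a. if a \<in> T then 0 else 1 - p"
  have "(\<Prod>a\<in>A - S. ?g a) = (1 - p) ^ (card A - card S) * of_bool (T \<subseteq> S)" if "S \<subseteq> A" for S
  proof -
    have fS: "finite S" using assms(1) that finite_subset by blast
    have "(\<Prod>a\<in>A - S. ?g a) = (\<Prod>a\<in>A - S. if a \<in> T - S then 0 else 1 - p)"
      by (rule prod.cong) auto
    \<comment> \<open>Since \<open>0 ^ 0 = 1\<close>, the first factor is the indicator of T
      \<subseteq> S.\<close>
    also have "\<dots> = 0 ^ card (T - S) * (1 - p) ^ card (A - S - (T - S))"
      by (rule prod_if_subset) (use assms in auto)
    also have "\<dots> = (1 - p) ^ (card A - card S) * of_bool (T \<subseteq> S)"
    proof (cases "T \<subseteq> S")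
      case True
      then have "T - S = {}" by blast
      then show ?thesis
        unfolding \<open>T - S = {}\<close> using True card_Diff_subset[OF fS that] by simp
    next
      case False
      then have "T - S \<noteq> {}" by blast
      moreover have "finite (T - S)" using finite_subset[OF assms(2,1)] by blast
      ultimately show ?thesis using False by (simp add: card_gt_0_iff)
    qed
    finally show ?thesis .
  qed
  then have "expect A p (\<lambda>S. of_bool (T \<subseteq> S)) = (\<Sum>S\<in>Pow A. (\<Prod>a\<in>S. p) * (\<Prod>a\<in>A - S. ?g a))"
    unfolding expect_def by (intro sum.cong) auto
  also have "\<dots> = (\<Prod>a\<in>A. p + ?g a)"
    by (rule prod_add[symmetric]) fact
  also have "\<dots> = (\<Prod>a\<in>A. if a \<in> T then p else 1)" by (rule prod.cong) auto
  also have "\<dots> = p ^ card T" using prod_if_subset[OF assms, of p 1] by simp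
  finally show ?thesis .
qed

text \<open>Dual to \<open>expect_superset\<close>: here the summand p is replaced by 0 on
  T.\<close>

lemma expect_disjoint:
  assumes "finite A" "T \<subseteq> A"
  shows "expect A p (\<lambda>S. of_bool (S \<inter> T = {})) = (1 - p) ^ card T"
proof -
  let ?f = "\<lambda>a. if a \<in> T then 0 else p"
  have "(\<Prod>a\<in>S. ?f a) = p ^ card S * of_bool (S \<inter> T = {})" if "S \<subseteq> A" for S
  proof -
    have fS: "finite S" using assms(1) that finite_subset by blast
    have "(\<Prod>a\<in>S. ?f a) = (\<Prod>a\<in>S. if a \<in> S \<inter> T then 0 else p)"
      by (rule prod.cong) auto
    also have "\<dots> = 0 ^ card (S \<inter> T) * p ^ card (S - S \<inter> T)"
      by (rule prod_if_subset) (use fS in auto)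
    also have "\<dots> = p ^ card S * of_bool (S \<inter> T = {})"
      using fS by (auto simp: card_eq_0_iff)
    finally show ?thesis .
  qed
  moreover have "card (A - S) = card A - card S" if "S \<subseteq> A" for S
    using card_Diff_subset[of S A] that assms(1) finite_subset by blast
  ultimately have "expect A p (\<lambda>S. of_bool (S \<inter> T = {})) = (\<Sum>S\<in>Pow A. (\<Prod>a\<in>S. ?f a) * (\<Prod>a\<in>A - S. 1 - p))"
    unfolding expect_def by (intro sum.cong) auto
  also have "\<dots> = (\<Prod>a\<in>A. ?f a + (1 - p))"
    by (rule prod_add[symmetric]) fact
  also have "\<dots> = (\<Prod>a\<in>A. if a \<in> T then 1 - p else 1)" by (rule prod.cong) auto
  also have "\<dots> = (1 - p) ^ card T" using prod_if_subset[OF assms, of "1 - p" 1] by simp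
  finally show ?thesis .
qed

text \<open>For T = {}, \<open>expect_superset\<close> says that the weights sum to 1.\<close>

lemma expect_const: "finite A \<Longrightarrow> expect A p (\<lambda>S. c) = c"
  using expect_superset[of A "{}" p] expect_cmult[of A p c "\<lambda>_. 1"] by simp

lemma expect_markov:
  assumes "0 \<le> p" "p \<le> 1" "0 < c" "\<And>S. S \<subseteq> A \<Longrightarrow> 0 \<le> X S"
  shows "expect A p (\<lambda>S. of_bool (c \<le> X S)) \<le> expect A p X / c"
proof -
  have "c * expect A p (\<lambda>S. of_bool (c \<le> X S)) \<le> expect A p X"
    unfolding expect_cmult[symmetric] by (rule expect_mono) (use assms in auto)
  then show ?thesis using assms(3) by (simp add: field_simps)
qed

lemma expect_card:
  assumes "finite A"
  shows "expect A p (\<lambda>S. real (card S)) = p * card A"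
proof -
  have "expect A p (\<lambda>S. real (card S)) = expect A p (\<lambda>S. \<Sum>a\<in>A. of_bool ({a} \<subseteq> S))"
    using assms by (intro expect_cong) (simp add: Int_absorb1 Collect_conj_eq flip: sum.inter_filter)
  also have "\<dots> = (\<Sum>a\<in>A. p)"
    unfolding expect_sum
  proof (rule sum.cong)
    fix a assume "a \<in> A"
    then show "expect A p (\<lambda>S. of_bool ({a} \<subseteq> S)) = p"
      using expect_superset[OF assms, of "{a}" p] by simp
  qed simp
  finally show ?thesis by simp
qed

text \<open>The square counts ordered pairs of elements of S. A diagonal pair is a singleton and
  contributes p, any other pair contributes the square of p.\<close>

lemma expect_card_squared:
  assumes "finite A"
  shows "expect A p (\<lambda>S. (real (card S))\<^sup>2) = p * card A + p\<^sup>2 * card A * (real (card A) - 1)"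
proof -
  have cardS: "real (card S) = (\<Sum>a\<in>A. of_bool (a \<in> S))" if "S \<subseteq> A" for S
    using assms that by (simp add: Int_absorb1 Collect_conj_eq flip: sum.inter_filter)
  have "expect A p (\<lambda>S. (real (card S))\<^sup>2) = expect A p (\<lambda>S. \<Sum>a\<in>A. \<Sum>b\<in>A. of_bool ({a, b} \<subseteq> S))"
    by (rule expect_cong) (simp add: cardS power2_eq_square sum_product of_bool_conj)
  also have "\<dots> = (\<Sum>a\<in>A. \<Sum>b\<in>A. p ^ card {a, b})"
    unfolding expect_sum by (intro sum.cong refl expect_superset assms) simp
  also have "\<dots> = (\<Sum>a\<in>A. p + p\<^sup>2 * (real (card A) - 1))"
  proof (rule sum.cong)
    fix a assume a: "a \<in> A"
    have "(\<Sum>b\<in>A. p ^ card {a, b}) = p ^ card {a, a} + (\<Sum>b\<in>A - {a}. p ^ card {a, b})"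
      using sum.remove[OF assms a, of "\<lambda>b. p ^ card {a, b}"] .
    also have "(\<Sum>b\<in>A - {a}. p ^ card {a, b}) = (\<Sum>b\<in>A - {a}. p\<^sup>2)"
      by (rule sum.cong) (auto simp: card_insert_if power2_eq_square)
    finally show "(\<Sum>b\<in>A. p ^ card {a, b}) = p + p\<^sup>2 * (real (card A) - 1)"
      using assms a card_gt_0_iff[of A] by (auto simp: of_nat_diff Suc_leI)
  qed simp
  finally show ?thesis by (simp add: algebra_simps)
qed

text \<open>The variance is p (1 - p) times the size of A, and the mean is a sufficient bound for
  it.\<close>

lemma expect_chebyshev_card:
  assumes "finite A" "0 \<le> p" "p \<le> 1" "0 < t"
  shows "expect A p (\<lambda>S. of_bool (t \<le> \<bar>real (card S) - p * card A\<bar>)) \<le> p * card A / t\<^sup>2"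
proof -
  let ?m = "p * real (card A)"
  have "expect A p (\<lambda>S. of_bool (t \<le> \<bar>real (card S) - ?m\<bar>))
      = expect A p (\<lambda>S. of_bool (t\<^sup>2 \<le> (real (card S) - ?m)\<^sup>2))"
    using assms(4) by (intro expect_cong) (simp add: abs_le_square_iff[symmetric])
  also have "\<dots> \<le> expect A p (\<lambda>S. (real (card S) - ?m)\<^sup>2) / t\<^sup>2"
    by (rule expect_markov) (use assms in auto)
  also have "expect A p (\<lambda>S. (real (card S) - ?m)\<^sup>2)
      = expect A p (\<lambda>S. (real (card S))\<^sup>2 + ((- 2 * ?m) * real (card S) + ?m\<^sup>2))"
    by (rule expect_cong) (simp add: power2_eq_square algebra_simps)
  also have "\<dots> = ?m - p\<^sup>2 * card A"
    unfolding expect_add expect_cmult expect_card[OF assms(1)] expect_card_squared[OF assms(1)]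
      expect_const[OF assms(1)] by (simp add: power2_eq_square algebra_simps)
  also have "\<dots> \<le> ?m" by simp
  finally show ?thesis using assms(4) by (simp add: divide_right_mono)
qed

section \<open>The random bipartite graph: isolated vertices, short cycles, the union bound\<close>

lemma Gnp_prob_expect:
  "Gnp_prob n1 n2 p P = expect ({..<n1} \<times> {..<n2}) p (\<lambda>S. of_bool (P S))"
  unfolding Gnp_prob_def expect_def by (rule sum.cong) auto

text \<open>A left vertex is isolated exactly when S misses its row of n2 pairs, which
  \<open>expect_disjoint\<close> evaluates.\<close>

lemma expect_isolated:
  "expect ({..<n1} \<times> {..<n2}) p (\<lambda>S. real n1 - real (card (fst ` S))) = real n1 * (1 - p) ^ n2"
proof -
  let ?A = "{..<n1} \<times> {..<n2}"
  have "expect ?A p (\<lambda>S. real n1 - real (card (fst ` S)))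
      = expect ?A p (\<lambda>S. \<Sum>i<n1. of_bool (S \<inter> ({i} \<times> {..<n2}) = {}))"
  proof (rule expect_cong)
    fix S assume S: "S \<subseteq> ?A"
    have fst: "fst ` S \<subseteq> {..<n1}" using S by auto
    have "(\<Sum>i<n1. of_bool (S \<inter> ({i} \<times> {..<n2}) = {}) :: real)
        = real (card {i \<in> {..<n1}. S \<inter> ({i} \<times> {..<n2}) = {}})"
      by (simp add: Int_def)
    also have "{i \<in> {..<n1}. S \<inter> ({i} \<times> {..<n2}) = {}} = {..<n1} - fst ` S"
    proof (intro set_eqI iffI)
      fix i assume "i \<in> {i \<in> {..<n1}. S \<inter> ({i} \<times> {..<n2}) = {}}"
      then show "i \<in> {..<n1} - fst ` S" using S by auto
    next
      fix i assume i: "i \<in> {..<n1} - fst ` S"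
      then have "(i, j) \<notin> S" for j by force
      then show "i \<in> {i \<in> {..<n1}. S \<inter> ({i} \<times> {..<n2}) = {}}" using i by auto
    qed
    also have "card \<dots> = n1 - card (fst ` S)"
      using fst by (simp add: card_Diff_subset finite_subset)
    finally show "real n1 - real (card (fst ` S)) = (\<Sum>i<n1. of_bool (S \<inter> ({i} \<times> {..<n2}) = {}))"
      using card_mono[OF _ fst] by (simp add: of_nat_diff)
  qed
  also have "\<dots> = (\<Sum>i<n1. (1 - p) ^ n2)"
    unfolding expect_sum
  proof (rule sum.cong)
    fix i assume "i \<in> {..<n1}"
    then show "expect ?A p (\<lambda>S. of_bool (S \<inter> ({i} \<times> {..<n2}) = {})) = (1 - p) ^ n2"
      using expect_disjoint[of ?A "{i} \<times> {..<n2}" p] by auto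
  qed simp
  finally show ?thesis by simp
qed

text \<open>If the edges at two different positions coincided, each position would be the cyclic
  successor of the other, which is impossible from length 3 on.\<close>

lemma card_cycle_edges:
  assumes "distinct xs" "3 \<le> length xs"
  shows "card ((\<lambda>i. {xs ! i, xs ! (Suc i mod length xs)}) ` {..<length xs}) = length xs"
proof -
  let ?l = "length xs"
  have "inj_on (\<lambda>i. {xs ! i, xs ! (Suc i mod ?l)}) {..<?l}"
  proof (rule inj_onI)
    fix i j assume ij: "i \<in> {..<?l}" "j \<in> {..<?l}"
      and eq: "{xs ! i, xs ! (Suc i mod ?l)} = {xs ! j, xs ! (Suc j mod ?l)}"
    have lt: "Suc k mod ?l < ?l" for k using assms(2) by (intro mod_less_divisor) linarith
    show "i = j"
    proof (rule ccontr)
      assume "i \<noteq> j"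
      then have "xs ! i \<noteq> xs ! j" using ij nth_eq_iff_index_eq[OF assms(1)] by simp
      then have "xs ! i = xs ! (Suc j mod ?l)" "xs ! (Suc i mod ?l) = xs ! j"
        using eq unfolding doubleton_eq_iff by blast+
      then have "i = Suc j mod ?l" "Suc i mod ?l = j"
        using ij lt nth_eq_iff_index_eq[OF assms(1)] by simp_all
      moreover have "Suc k mod ?l = (if Suc k = ?l then 0 else Suc k)" if "k < ?l" for k
        using that by (simp add: mod_Suc)
      ultimately show False using ij assms(2) by (simp split: if_splits)
    qed
  qed
  then show ?thesis by (simp add: card_image)
qed

text \<open>A list that is a short cycle in no subgraph has probability 0. Otherwise one subgraph
  \<open>S0\<close> containing it serves to translate its edges into a set T of pairs, and every S
  with this cycle contains T.\<close>

lemma expect_cycle_le: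
  assumes "finite A" "0 \<le> p" "p \<le> 1"
  shows "expect A p (\<lambda>S. of_bool (xs \<in> short_cycles (bip_edges S) K)) \<le> p ^ length xs"
proof (cases "\<exists>S\<subseteq>A. xs \<in> short_cycles (bip_edges S) K")
  case False
  then have "expect A p (\<lambda>S. of_bool (xs \<in> short_cycles (bip_edges S) K)) = expect A p (\<lambda>S. 0)"
    by (intro expect_cong) auto
  then show ?thesis using assms by (simp add: expect_const)
next
  case True
  then obtain S0 where S0: "S0 \<subseteq> A" "xs \<in> short_cycles (bip_edges S0) K" by blast
  let ?g = "\<lambda>(i, j). {Inl i, Inr j}"
  let ?F = "(\<lambda>i. {xs ! i, xs ! (Suc i mod length xs)}) ` {..<length xs}"
  define T where "T = {t \<in> S0. ?g t \<in> ?F}"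
  have F_sub: "?F \<subseteq> bip_edges S" if "xs \<in> short_cycles (bip_edges S) K" for S
    using that by (auto simp: short_cycles_def)
  have "?F = ?g ` T"
  proof
    show "?F \<subseteq> ?g ` T"
    proof
      fix e assume e: "e \<in> ?F"
      then obtain t where "t \<in> S0" "e = ?g t"
        using F_sub[OF S0(2)] unfolding bip_edges_image by (metis (no_types, lifting) imageE subsetD)
      then show "e \<in> ?g ` T" using e unfolding T_def by blast
    qed
    show "?g ` T \<subseteq> ?F" unfolding T_def by (rule image_subsetI) simp
  qed
  moreover have "card ?F = length xs"
    by (rule card_cycle_edges) (use S0 in \<open>auto simp: short_cycles_def\<close>)
  ultimately have cT: "card T = length xs" using card_image[OF inj_bip_edge, of T] by simp
  have TS: "T \<subseteq> S" if "xs \<in> short_cycles (bip_edges S) K" for S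
  proof
    fix t assume "t \<in> T"
    then have "?g t \<in> ?F" by (simp add: T_def)
    then have "?g t \<in> ?g ` S" using F_sub[OF that] unfolding bip_edges_image by (rule rev_subsetD)
    then show "t \<in> S" using inj_image_mem_iff[OF inj_bip_edge] by metis
  qed
  have "expect A p (\<lambda>S. of_bool (xs \<in> short_cycles (bip_edges S) K)) \<le> expect A p (\<lambda>S. of_bool (T \<subseteq> S))"
    by (rule expect_mono) (use assms TS in auto)
  also have "\<dots> = p ^ length xs"
  proof -
    have "T \<subseteq> A" unfolding T_def by (rule order_trans[OF Collect_restrict S0(1)])
    then show ?thesis using expect_superset[OF assms(1), of T p] cT by simp
  qed
  finally show ?thesis .
qed

lemma expect_short_cycles_le:
  assumes "0 \<le> p" "p \<le> 1"
  shows "expect ({..<n1} \<times> {..<n2}) p (\<lambda>S. real (card (short_cycles (bip_edges S) K)))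
    \<le> (\<Sum>l\<le>K. (real (n1 + n2) * p) ^ l)"
proof -
  let ?A = "{..<n1} \<times> {..<n2}"
  let ?V = "Inl ` {..<n1} \<union> Inr ` {..<n2} :: (nat + nat) set"
  let ?L = "{xs. set xs \<subseteq> ?V \<and> length xs \<le> K}"
  have finL: "finite ?L" by (rule finite_lists_length_le) simp
  have cV: "card ?V = n1 + n2"
    by (subst card_Un_disjoint) (auto simp: card_image)
  have "expect ?A p (\<lambda>S. real (card (short_cycles (bip_edges S) K)))
      = expect ?A p (\<lambda>S. \<Sum>xs\<in>?L. of_bool (xs \<in> short_cycles (bip_edges S) K))"
  proof (rule expect_cong)
    fix S assume S: "S \<subseteq> ?A"
    then have "fst ` S \<subseteq> {..<n1}" "snd ` S \<subseteq> {..<n2}" by auto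
    then have "\<Union>(bip_edges S) \<subseteq> ?V" unfolding Union_bip_edges by blast
    then have "{xs. set xs \<subseteq> \<Union>(bip_edges S) \<and> length xs \<le> K} \<subseteq> ?L"
      by (intro Collect_mono impI conjI) (erule conjE, erule order_trans, assumption, erule conjunct2)
    then have "short_cycles (bip_edges S) K \<subseteq> ?L" by (rule order_trans[OF short_cycles_subset])
    then show "real (card (short_cycles (bip_edges S) K)) = (\<Sum>xs\<in>?L. of_bool (xs \<in> short_cycles (bip_edges S) K))"
      using finL by (simp add: Int_absorb1)
  qed
  also have "\<dots> \<le> (\<Sum>xs\<in>?L. p ^ length xs)"
    unfolding expect_sum by (intro sum_mono expect_cycle_le) (use assms in auto)
  also have "\<dots> = (\<Sum>l\<le>K. \<Sum>xs\<in>{xs \<in> ?L. length xs = l}. p ^ length xs)"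
    by (rule sum.group[symmetric]) (use finL in auto)
  also have "\<dots> = (\<Sum>l\<le>K. (real (n1 + n2) * p) ^ l)"
  proof (rule sum.cong)
    fix l assume "l \<in> {..K}"
    then have "{xs \<in> ?L. length xs = l} = {xs. set xs \<subseteq> ?V \<and> length xs = l}" by auto
    then show "(\<Sum>xs\<in>{xs \<in> ?L. length xs = l}. p ^ length xs) = (real (n1 + n2) * p) ^ l"
      using card_lists_length_eq[of ?V l] cV by (simp add: power_mult_distrib)
  qed simp
  finally show ?thesis .
qed

text \<open>Union bound over three bad events, estimated by Chebyshev, Markov and Markov. The factor
  2 comes from comparing the expected number of isolated left vertices with n1 / 2.\<close>

lemma Gnp_prob_good_ge:
  assumes "0 \<le> p" "p \<le> 1" "0 < t" "0 < c" "0 < n1"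
    and good: "\<And>S. S \<subseteq> {..<n1} \<times> {..<n2} \<Longrightarrow> \<bar>real (card S) - p * real (n1 * n2)\<bar> < t \<Longrightarrow>
      real n1 / 2 < real (card (fst ` S)) \<Longrightarrow> real (card (short_cycles (bip_edges S) K)) < c \<Longrightarrow> P S"
  shows "Gnp_prob n1 n2 p P \<ge> 1 - p * real (n1 * n2) / t\<^sup>2 - 2 * (1 - p) ^ n2
    - (\<Sum>l\<le>K. (real (n1 + n2) * p) ^ l) / c"
proof -
  let ?A = "{..<n1} \<times> {..<n2}"
  let ?b1 = "\<lambda>S. of_bool (t \<le> \<bar>real (card S) - p * real (n1 * n2)\<bar>) :: real"
  let ?b2 = "\<lambda>S. of_bool (real n1 / 2 \<le> real n1 - real (card (fst ` S))) :: real"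
  let ?b3 = "\<lambda>S. of_bool (c \<le> real (card (short_cycles (bip_edges S) K))) :: real"
  have fin: "finite ?A" by simp
  have "1 = expect ?A p (\<lambda>S. 1)" by (simp add: expect_const)
  also have "\<dots> \<le> expect ?A p (\<lambda>S. of_bool (P S) + (?b1 S + (?b2 S + ?b3 S)))"
  proof (rule expect_mono)
    fix S assume S: "S \<subseteq> ?A"
    show "1 \<le> of_bool (P S) + (?b1 S + (?b2 S + ?b3 S))"
    proof (rule ccontr)
      assume "\<not> 1 \<le> of_bool (P S) + (?b1 S + (?b2 S + ?b3 S))"
      then have "\<not> P S" "\<not> t \<le> \<bar>real (card S) - p * real (n1 * n2)\<bar>"
        "\<not> real n1 / 2 \<le> real n1 - real (card (fst ` S))"
        "\<not> c \<le> real (card (short_cycles (bip_edges S) K))"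
        by (auto simp only: of_bool_def split: if_splits)
      then show False using good[OF S] by linarith
    qed
  qed (use assms in auto)
  also have "\<dots> = Gnp_prob n1 n2 p P + (expect ?A p ?b1 + (expect ?A p ?b2 + expect ?A p ?b3))"
    by (simp only: Gnp_prob_expect
      expect_add[of ?A p "\<lambda>S. of_bool (P S)" "\<lambda>S. ?b1 S + (?b2 S + ?b3 S)"]
      expect_add[of ?A p ?b1 "\<lambda>S. ?b2 S + ?b3 S"] expect_add[of ?A p ?b2 ?b3])
  finally have "1 \<le> Gnp_prob n1 n2 p P + (expect ?A p ?b1 + (expect ?A p ?b2 + expect ?A p ?b3))" .
  moreover have "expect ?A p ?b1 \<le> p * real (n1 * n2) / t\<^sup>2"
    using expect_chebyshev_card[OF fin assms(1-3)] by simp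
  moreover have "expect ?A p ?b2 \<le> real n1 * (1 - p) ^ n2 / (real n1 / 2)"
    unfolding expect_isolated[symmetric]
  proof (rule expect_markov)
    fix S assume "S \<subseteq> ?A"
    then have "card (fst ` S) \<le> card {..<n1}" by (intro card_mono) auto
    then show "0 \<le> real n1 - real (card (fst ` S))" by simp
  qed (use assms in auto)
  moreover have "expect ?A p ?b3 \<le> (\<Sum>l\<le>K. (real (n1 + n2) * p) ^ l) / c"
    using expect_markov[of p c ?A "\<lambda>S. real (card (short_cycles (bip_edges S) K))"]
      divide_right_mono[OF expect_short_cycles_le[OF assms(1,2), of n1 n2 K], of c] assms by simp
  ultimately show ?thesis using assms(5) by simp
qed

lemma Gnp_prob_le_1:
  assumes "0 \<le> p" "p \<le> 1"
  shows "Gnp_prob n1 n2 p P \<le> 1"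
proof -
  have "Gnp_prob n1 n2 p P \<le> expect ({..<n1} \<times> {..<n2}) p (\<lambda>S. 1)"
    unfolding Gnp_prob_expect by (rule expect_mono) (use assms in auto)
  then show ?thesis by (simp add: expect_const)
qed

section \<open>Asymptotics\<close>

text \<open>Converts convergence at every fixed precision index m into convergence along some m k
  tending to infinity; this yields one error function \<delta>.\<close>

lemma diagonal_limit:
  fixes Q :: "nat \<Rightarrow> nat \<Rightarrow> real"
  assumes "\<And>m. Q m \<longlonglongrightarrow> L"
  obtains m where "filterlim m at_top sequentially" "(\<lambda>k. Q (m k) k) \<longlonglongrightarrow> L"
proof -
  have "\<exists>N. \<forall>k\<ge>N. dist (Q m k) L < 1 / real (Suc m)" for m
    using assms[of m] by (auto simp: lim_sequentially)
  then obtain N where N: "\<And>m k. N m \<le> k \<Longrightarrow> dist (Q m k) L < 1 / real (Suc m)" by metis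
  \<comment> \<open>m k will be the largest index whose threshold has been passed by time k. The
    bound m \<le> k keeps the set finite, and the exception for m = 0 keeps it nonempty.\<close>
  define A where "A k = {m. m \<le> k \<and> (m = 0 \<or> N m \<le> k)}" for k
  have finA: "finite (A k)" for k by (rule finite_subset[of _ "{..k}"]) (auto simp: A_def)
  define m where "m k = Max (A k)" for k
  have "0 \<in> A k" for k by (simp add: A_def)
  then have mA: "m k \<in> A k" for k unfolding m_def using finA[of k] by (intro Max_in) auto
  have m_ge: "J \<le> m k" if "J \<le> k" "N J \<le> k" for J k
    unfolding m_def by (rule Max_ge[OF finA]) (use that in \<open>simp add: A_def\<close>)
  have lim_m: "filterlim m at_top sequentially"
    unfolding filterlim_at_top eventually_sequentially
    using m_ge by (metis max.boundedE)
  have "(\<lambda>k. 1 / real (Suc (m k))) \<longlonglongrightarrow> 0"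
    using filterlim_compose[OF LIMSEQ_Suc[OF lim_1_over_n] lim_m] by simp
  moreover have "\<forall>\<^sub>F k in sequentially. norm (Q (m k) k - L) \<le> 1 / real (Suc (m k))"
  proof -
    have "\<forall>\<^sub>F k in sequentially. 1 \<le> m k" using lim_m by (simp add: filterlim_at_top)
    then show ?thesis
    proof eventually_elim
      case (elim k)
      then have "N (m k) \<le> k" using mA[of k] by (auto simp: A_def)
      then show ?case using N[of "m k" k] by (simp add: dist_norm)
    qed
  qed
  ultimately have "(\<lambda>k. Q (m k) k - L) \<longlonglongrightarrow> 0" by (rule Lim_null_comparison[rotated])
  then show ?thesis using that lim_m LIM_zero_iff by blast
qed

text \<open>The relative error \<eta> is spent in three shares: \<eta> / 4 on long faces, \<eta> / 4
  on short cycles, and \<eta> / 2 on vertices together with the fluctuation n1 / 4. For the upper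
  bound, an excess of n1 / 4 edges is outweighed by n1 / 2 nonisolated left vertices.\<close>

lemma good_genus:
  fixes p \<eta> :: real
  assumes S: "S \<subseteq> {..<n1} \<times> {..<n2}" and \<eta>: "0 < \<eta>" "\<eta> \<le> 1"
    and M: "M = p * real (n1 * n2)"
    and "\<bar>real (card S) - M\<bar> < real n1 / 4"
    and "real n1 / 2 < real (card (fst ` S))"
    and "real (card (short_cycles (bip_edges S) K)) < \<eta> / 4 * M"
    and K: "2 / (real K + 1) \<le> \<eta> / 4"
    and "3 * real (n1 + n2) \<le> \<eta> / 2 * M"
  shows "(1 - \<eta>) * M \<le> 2 * real (genus (bip_edges S))" "2 * real (genus (bip_edges S)) \<le> M"
proof -
  have fin: "finite S" using S by (rule finite_subset) simp
  have "real (2 * genus (bip_edges S) + card (fst ` S)) \<le> real (card S)"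
    using genus_bip_upper[OF fin] of_nat_le_iff by blast
  then have "2 * real (genus (bip_edges S)) + real (card (fst ` S)) \<le> real (card S)" by simp
  then show "2 * real (genus (bip_edges S)) \<le> M" using assms(5,6) by linarith
  define r where "r = 2 / (real K + 1)"
  have r: "0 \<le> r" "r \<le> \<eta> / 4" using K by (simp_all add: r_def)
  have "card (fst ` S) \<le> card {..<n1}" "card (snd ` S) \<le> card {..<n2}"
    using S by (intro card_mono; auto)+
  then have V: "real (card (\<Union>(bip_edges S))) \<le> real (n1 + n2)"
    using card_Union_bip_edges[OF fin] by simp
  have "0 \<le> \<eta> / 2 * M" by (rule order_trans[OF _ assms(9)]) simp
  then have M0: "0 \<le> M" using \<eta> by (simp add: zero_le_mult_iff)
  have "M - real n1 / 4 \<le> real (card S)" "0 \<le> 1 - r" using assms(5) r \<eta> by linarith+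
  then have "(M - real n1 / 4) * (1 - r) \<le> real (card S) * (1 - r)" by (rule mult_right_mono)
  moreover have "(M - real n1 / 4) * (1 - r) \<ge> M - \<eta> / 4 * M - real n1 / 4"
  proof -
    have "(M - x) * (1 - r) = M - r * M - x + r * x" for x r :: real by (simp add: algebra_simps)
    moreover have "0 \<le> r * (real n1 / 4)" using r by simp
    ultimately show ?thesis using mult_right_mono[OF r(2) M0] by (simp only:)
  qed
  ultimately have E: "M - \<eta> / 4 * M - real n1 / 4 \<le> real (card S) * (1 - r)" by (rule order_trans[rotated])
  have "real (card S) * (1 - r) - 2 * real (card (\<Union>(bip_edges S))) - real (card (short_cycles (bip_edges S) K))
      \<le> 2 * real (genus (bip_edges S))"
    using genus_lower[OF simple_graph_bip_edges[OF fin], of K] by (simp only: card_bip_edges r_def)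
  then have "M - \<eta> / 4 * M - real n1 / 4 - 2 * real (n1 + n2) - \<eta> / 4 * M \<le> 2 * real (genus (bip_edges S))"
    using E V assms(7) by argo
  moreover have "real n1 / 4 + 2 * real (n1 + n2) \<le> \<eta> / 2 * M" using assms(9) by simp
  ultimately show "(1 - \<eta>) * M \<le> 2 * real (genus (bip_edges S))"
    by (simp add: algebra_simps)
qed

lemma one_minus_power_le_exp:
  fixes p :: real
  assumes "p \<le> 1"
  shows "(1 - p) ^ n \<le> exp (- (p * real n))"
proof -
  have "(1 - p) ^ n \<le> exp (- p) ^ n"
    using assms exp_ge_add_one_self[of "- p"] by (intro power_mono) auto
  then show ?thesis by (simp add: exp_of_nat_mult[symmetric] mult.commute)
qed

section \<open>The regime of the edge probability and the limit for a fixed relative error\<close>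

locale sparse_regime =
  fixes lam :: real and n1 n2 :: "nat \<Rightarrow> nat" and p :: "nat \<Rightarrow> real"
  assumes lam: "0 < lam" "lam \<le> 1"
    and n1_lim: "filterlim n1 at_top sequentially"
    and n1_eq: "\<And>k. real (n1 k) = lam * real (n2 k)"
    and p01: "\<And>k. 0 \<le> p k" "\<And>k. p k \<le> 1"
    and p_lower: "(\<lambda>k. (real (n1 k) * real (n2 k)) powr (-1/2)) \<in> o(p)"
    and p_upper: "\<exists>\<epsilon>::nat \<Rightarrow> real. \<epsilon> \<longlonglongrightarrow> 0 \<and>
           p \<in> o(\<lambda>k. (real (n1 k) * real (n2 k)) powr (-1/2 + \<epsilon> k))"
begin

text \<open>Through this identity all asymptotics are expressed in \<open>n2\<close> alone, the
  square root of n1 n2 being \<open>sqrt lam * n2\<close>.\<close>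

lemma n1_n2: "real (n1 k) * real (n2 k) = lam * (real (n2 k))\<^sup>2"
  by (simp add: n1_eq power2_eq_square)

lemma n2_lim: "filterlim (\<lambda>k. real (n2 k)) at_top sequentially"
proof -
  have "filterlim (\<lambda>k. real (n1 k)) at_top sequentially"
    by (rule filterlim_compose[OF filterlim_real_sequentially n1_lim])
  then have "filterlim (\<lambda>k. (1 / lam) * real (n1 k)) at_top sequentially"
    using lam by (intro filterlim_tendsto_pos_mult_at_top[OF tendsto_const]) auto
  then show ?thesis using lam by (simp add: n1_eq)
qed

lemma ev_n2_ge: "\<forall>\<^sub>F k in sequentially. c \<le> real (n2 k)"
  using n2_lim by (simp add: filterlim_at_top)

lemma pn_lim: "filterlim (\<lambda>k. p k * real (n2 k)) at_top sequentially"
  unfolding filterlim_at_top_gt[where c = 0]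
proof (intro allI impI)
  fix Z :: real assume Z: "Z > 0"
  \<comment> \<open>Chosen so that 1 / (sqrt lam * n2) \<le> ?c * p rearranges to Z \<le> p *
    n2.\<close>
  let ?c = "1 / (Z * sqrt lam)"
  have "\<forall>\<^sub>F k in sequentially. norm ((real (n1 k) * real (n2 k)) powr (-1/2)) \<le> ?c * norm (p k)"
    by (rule landau_o.smallD[OF p_lower]) (use Z lam in simp)
  then show "\<forall>\<^sub>F k in sequentially. Z \<le> p k * real (n2 k)"
    using ev_n2_ge[of 1]
  proof eventually_elim
    case (elim k)
    have "(real (n1 k) * real (n2 k)) powr (-1/2) = 1 / sqrt (real (n1 k) * real (n2 k))"
      by (simp add: powr_minus_divide powr_half_sqrt)
    also have "\<dots> = 1 / (sqrt lam * real (n2 k))"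
      by (simp add: n1_n2 real_sqrt_mult)
    finally have "1 / (sqrt lam * real (n2 k)) \<le> ?c * p k" using elim(1) p01 lam by (simp add: abs_mult)
    then show ?case using lam Z elim(2) by (simp add: field_simps)
  qed
qed

lemma ev_pn_ge: "\<forall>\<^sub>F k in sequentially. c \<le> p k * real (n2 k)"
  using pn_lim by (simp add: filterlim_at_top)

text \<open>This is where the exponent o(1) matters: for fixed K, the K-th power of p n2 is
  eventually below a constant times the square root of n2.\<close>

lemma pn_power_lim: "(\<lambda>k. (p k * real (n2 k)) ^ K / real (n2 k)) \<longlonglongrightarrow> 0"
proof -
  obtain \<epsilon> :: "nat \<Rightarrow> real" where \<epsilon>: "\<epsilon> \<longlonglongrightarrow> 0"
    "p \<in> o(\<lambda>k. (real (n1 k) * real (n2 k)) powr (-1/2 + \<epsilon> k))" using p_upper by blast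
  \<comment> \<open>With this e, the exponent e * K stays below 1/4. As n1 n2 is at most the square
    of n2, its power is then at most n2 to the 1/2.\<close>
  define e where "e = 1 / (4 * (real K + 1))"
  have e: "0 < e" by (simp add: e_def)
  have "\<forall>\<^sub>F k in sequentially. \<epsilon> k < e" using order_tendstoD(2)[OF \<epsilon>(1) e] .
  moreover have "\<forall>\<^sub>F k in sequentially. norm (p k) \<le> 1 * norm ((real (n1 k) * real (n2 k)) powr (-1/2 + \<epsilon> k))"
    by (rule landau_o.smallD[OF \<epsilon>(2)]) simp
  ultimately have "\<forall>\<^sub>F k in sequentially. norm ((p k * real (n2 k)) ^ K / real (n2 k))
      \<le> (1 / sqrt lam) ^ K * (real (n2 k)) powr (-1/2)"
    \<comment> \<open>This gives lam * n2 \<ge> 1 and hence n1 n2 \<ge> 1, so that powers increase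
      with the exponent.\<close>
    using ev_n2_ge[of "1 / lam"]
  proof eventually_elim
    case (elim k)
    let ?a = "real (n2 k)" and ?N = "real (n1 k) * real (n2 k)"
    have "1 \<le> lam * ?a" using elim(3) lam by (simp add: field_simps)
    moreover have "lam * ?a \<le> ?a" using lam by (simp add: mult_left_le_one_le)
    ultimately have a1: "1 \<le> ?a" "1 \<le> lam * ?a" by linarith+
    have N1: "1 \<le> ?N" using mult_mono[OF a1(2) a1(1)] a1 by (simp add: n1_eq)
    have Na: "?N \<le> ?a\<^sup>2" using lam by (simp add: n1_n2 mult_left_le_one_le)
    have sqrtN: "sqrt ?N = sqrt lam * ?a" by (simp add: n1_n2 real_sqrt_mult)
    have "p k \<le> ?N powr (-1/2 + \<epsilon> k)" using elim(2) p01 by simp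
    also have "\<dots> \<le> ?N powr (-1/2 + e)" using elim(1) N1 by (intro powr_mono) auto
    finally have "p k * sqrt ?N \<le> ?N powr (-1/2 + e) * sqrt ?N" by (rule mult_right_mono) simp
    also have "\<dots> = ?N powr e" using N1 by (simp add: powr_half_sqrt[symmetric] powr_add[symmetric])
    finally have "sqrt lam * (p k * ?a) \<le> ?N powr e" unfolding sqrtN by (simp add: mult_ac)
    then have "p k * ?a \<le> (1 / sqrt lam) * ?N powr e" using lam by (simp add: field_simps)
    then have "(p k * ?a) ^ K \<le> ((1 / sqrt lam) * ?N powr e) ^ K" using p01 by (intro power_mono) auto
    also have "\<dots> = (1 / sqrt lam) ^ K * ?N powr (e * real K)"
    proof -
      have "?N \<noteq> 0" using N1 by linarith
      then have "(?N powr e) ^ K = ?N powr (e * real K)"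
        by (subst powr_power) (simp_all add: mult.commute)
      then show ?thesis by (simp only: power_mult_distrib)
    qed
    also have "\<dots> \<le> (1 / sqrt lam) ^ K * ?a powr (1/2)"
    proof (rule mult_left_mono)
      have "?N powr (e * real K) \<le> ?N powr (1/4)"
        using N1 by (intro powr_mono) (auto simp: e_def field_simps)
      also have "\<dots> \<le> (?a\<^sup>2) powr (1/4)" using Na N1 by (intro powr_mono2) auto
      also have "\<dots> = ?a powr (1/2)" using a1 by (simp add: powr_powr flip: powr_numeral)
      finally show "?N powr (e * real K) \<le> ?a powr (1/2)" .
    qed (use lam in simp)
    finally have "(p k * ?a) ^ K / ?a \<le> (1 / sqrt lam) ^ K * ?a powr (1/2) / ?a"
      by (rule divide_right_mono) simp
    also have "\<dots> = (1 / sqrt lam) ^ K * ?a powr (-1/2)"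
      using a1 powr_diff[of ?a "1/2" 1] by simp
    finally show ?case using p01 by simp
  qed
  moreover have "(\<lambda>k. (1 / sqrt lam) ^ K * (real (n2 k)) powr (-1/2)) \<longlonglongrightarrow> 0"
    by (intro tendsto_mult_right_zero tendsto_neg_powr n2_lim) simp
  ultimately show ?thesis by (rule Lim_null_comparison)
qed

lemma p_lim: "p \<longlonglongrightarrow> 0"
proof (rule Lim_transform_eventually[OF pn_power_lim[of 1]])
  show "\<forall>\<^sub>F k in sequentially. (p k * real (n2 k)) ^ 1 / real (n2 k) = p k"
    using ev_n2_ge[of 1] by eventually_elim simp
qed

text \<open>With \<eta> fixed, K is a constant, and each error term of
  \<open>Gnp_prob_good_ge\<close> tends to 0 by \<open>p_lim\<close>, \<open>pn_lim\<close> or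
  \<open>pn_power_lim\<close>.\<close>

lemma genus_prob_lim:
  assumes \<eta>: "0 < \<eta>" "\<eta> \<le> 1"
  shows "(\<lambda>k. Gnp_prob (n1 k) (n2 k) (p k)
        (\<lambda>S. (1 - \<eta>) * (1/2) * p k * real (n1 k) * real (n2 k) \<le> real (genus (bip_edges S))
           \<and> real (genus (bip_edges S)) \<le> (1/2) * p k * real (n1 k) * real (n2 k)))
    \<longlonglongrightarrow> 1" (is "?Q \<longlonglongrightarrow> 1")
proof -
  obtain K :: nat where "8 / \<eta> \<le> real K" using real_arch_simple by blast
  then have K: "2 / (real K + 1) \<le> \<eta> / 4" using \<eta> by (simp add: field_simps)
  let ?a = "\<lambda>k. real (n2 k)"
  \<comment> \<open>There are K + 1 summands, each at most (2 p n2) ^ K because n1 + n2 \<le> 2 n2.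
    They are divided by the Markov threshold \<eta> / 4 * M, for which M \<ge> lam * n2 is
    used.\<close>
  let ?C = "real (K + 1) * 2 ^ K * 4 / (\<eta> * lam)"
  let ?low = "\<lambda>k. 1 - 16 / lam * p k - 2 * exp (- (p k * ?a k)) - ?C * ((p k * ?a k) ^ K / ?a k)"
  have "?low \<longlonglongrightarrow> 1 - 16 / lam * 0 - 2 * 0 - ?C * 0"
  proof (intro tendsto_intros p_lim pn_power_lim)
    show "(\<lambda>k. exp (- (p k * ?a k))) \<longlonglongrightarrow> 0"
      using filterlim_compose[OF exp_at_bot filterlim_compose[OF filterlim_uminus_at_bot_at_top pn_lim]] .
  qed
  then have low: "?low \<longlonglongrightarrow> 1" by simp
  have "\<forall>\<^sub>F k in sequentially. ?low k \<le> ?Q k"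
    \<comment> \<open>p n2 \<ge> 1 serves for M \<ge> lam * n2 and for enlarging exponents up to K.
      The constant 12 / (\<eta> * lam) makes \<eta> / 2 * M at least 6 n2, hence at least 3 (n1 +
      n2).\<close>
    using ev_n2_ge[of 1] ev_pn_ge[of 1] ev_pn_ge[of "12 / (\<eta> * lam)"]
  proof eventually_elim
    case (elim k)
    define M where "M = p k * real (n1 k * n2 k)"
    have a: "1 \<le> ?a k" by (fact elim(1))
    have n1_le: "real (n1 k) \<le> ?a k" using lam by (simp add: n1_eq mult_left_le_one_le)
    have n1_pos: "0 < real (n1 k)" using lam a by (simp add: n1_eq)
    have Ma: "M = lam * (p k * ?a k) * ?a k" by (simp add: M_def n1_eq)
    have M_ge: "lam * ?a k \<le> M"
      unfolding Ma using elim(2) lam by (intro mult_right_mono) auto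
    have M_pos: "0 < M" using M_ge lam a by (smt (verit) mult_pos_pos)
    have "3 * real (n1 k + n2 k) \<le> 6 * ?a k" using n1_le by simp
    also have "\<dots> = \<eta> / 2 * (lam * (12 / (\<eta> * lam)) * ?a k)" using \<eta> lam by simp
    also have "\<dots> \<le> \<eta> / 2 * M"
      unfolding Ma using elim(3) \<eta> lam by (intro mult_left_mono mult_right_mono) auto
    finally have vert: "3 * real (n1 k + n2 k) \<le> \<eta> / 2 * M" .
    have "1 - p k * real (n1 k * n2 k) / (real (n1 k) / 4)\<^sup>2 - 2 * (1 - p k) ^ n2 k
        - (\<Sum>l\<le>K. (real (n1 k + n2 k) * p k) ^ l) / (\<eta> / 4 * M) \<le> ?Q k"
    proof (rule Gnp_prob_good_ge[OF p01])
      fix S assume S: "S \<subseteq> {..<n1 k} \<times> {..<n2 k}"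
        "\<bar>real (card S) - p k * real (n1 k * n2 k)\<bar> < real (n1 k) / 4"
        "real (n1 k) / 2 < real (card (fst ` S))"
        "real (card (short_cycles (bip_edges S) K)) < \<eta> / 4 * M"
      have "(1 - \<eta>) * M \<le> 2 * real (genus (bip_edges S))" "2 * real (genus (bip_edges S)) \<le> M"
        using good_genus[OF S(1) \<eta> M_def S(2)[folded M_def] S(3,4) K vert] by auto
      then show "(1 - \<eta>) * (1/2) * p k * real (n1 k) * real (n2 k) \<le> real (genus (bip_edges S))
           \<and> real (genus (bip_edges S)) \<le> (1/2) * p k * real (n1 k) * real (n2 k)"
        by (simp add: M_def algebra_simps)
    qed (use n1_pos M_pos \<eta> in auto)
    moreover have "p k * real (n1 k * n2 k) / (real (n1 k) / 4)\<^sup>2 = 16 / lam * p k"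
      using lam a by (simp add: n1_eq power2_eq_square)
    moreover have "(1 - p k) ^ n2 k \<le> exp (- (p k * ?a k))"
      using p01(2) by (rule one_minus_power_le_exp)
    moreover have "(\<Sum>l\<le>K. (real (n1 k + n2 k) * p k) ^ l) / (\<eta> / 4 * M) \<le> ?C * ((p k * ?a k) ^ K / ?a k)"
    proof -
      have base: "0 \<le> real (n1 k + n2 k) * p k" "real (n1 k + n2 k) * p k \<le> 2 * (p k * ?a k)"
        using n1_le p01 mult_right_mono[of "real (n1 k + n2 k)" "2 * ?a k" "p k"] by (auto simp: mult_ac)
      have "(real (n1 k + n2 k) * p k) ^ l \<le> (2 * (p k * ?a k)) ^ K" if "l \<le> K" for l
      proof -
        have "(real (n1 k + n2 k) * p k) ^ l \<le> (2 * (p k * ?a k)) ^ l" using base by (intro power_mono)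
        also have "\<dots> \<le> (2 * (p k * ?a k)) ^ K" using that elim(2) by (intro power_increasing) auto
        finally show ?thesis .
      qed
      then have "(\<Sum>l\<le>K. (real (n1 k + n2 k) * p k) ^ l) \<le> real (K + 1) * (2 * (p k * ?a k)) ^ K"
        using sum_bounded_above[of "{..K}" "\<lambda>l. (real (n1 k + n2 k) * p k) ^ l"] by simp
      then have "(\<Sum>l\<le>K. (real (n1 k + n2 k) * p k) ^ l) / (\<eta> / 4 * M)
          \<le> real (K + 1) * (2 * (p k * ?a k)) ^ K / (\<eta> / 4 * (lam * ?a k))"
        using M_ge \<eta> lam a base elim(2)
        by (intro frac_le mult_left_mono) (auto intro!: mult_pos_pos)
      also have "\<dots> = ?C * ((p k * ?a k) ^ K / ?a k)"
        by (simp add: power_mult_distrib field_simps)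
      finally show ?thesis .
    qed
    ultimately show ?case by linarith
  qed
  moreover have "\<forall>\<^sub>F k in sequentially. ?Q k \<le> 1" using p01 Gnp_prob_le_1 by simp
  ultimately show ?thesis by (rule tendsto_sandwich[OF _ _ low tendsto_const])
qed

end

theorem theorem1p5:
  fixes lam :: real and n1 n2 :: "nat \<Rightarrow> nat" and p :: "nat \<Rightarrow> real"
  assumes "0 < lam" and "lam \<le> 1"
    and "filterlim n1 at_top sequentially"
    and "\<forall>k. real (n1 k) = lam * real (n2 k)"
    and "\<forall>k. 0 \<le> p k \<and> p k \<le> 1"
    and "(\<lambda>k. (real (n1 k) * real (n2 k)) powr (-1/2)) \<in> o(p)"
    and "\<exists>\<epsilon>::nat \<Rightarrow> real. \<epsilon> \<longlonglongrightarrow> 0 \<and>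
           p \<in> o(\<lambda>k. (real (n1 k) * real (n2 k)) powr (-1/2 + \<epsilon> k))"
  shows "\<exists>\<delta>::nat \<Rightarrow> real. \<delta> \<longlonglongrightarrow> 0 \<and>
    (\<lambda>k. Gnp_prob (n1 k) (n2 k) (p k)
        (\<lambda>S. (1 - \<delta> k) * (1/2) * p k * real (n1 k) * real (n2 k) \<le> real (genus (bip_edges S))
           \<and> real (genus (bip_edges S)) \<le> (1/2) * p k * real (n1 k) * real (n2 k)))
    \<longlonglongrightarrow> 1"
proof -
  interpret sparse_regime lam n1 n2 p
    using assms by unfold_locales auto
  let ?Q = "\<lambda>m k. Gnp_prob (n1 k) (n2 k) (p k)
        (\<lambda>S. (1 - 1 / real (Suc m)) * (1/2) * p k * real (n1 k) * real (n2 k) \<le> real (genus (bip_edges S))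
           \<and> real (genus (bip_edges S)) \<le> (1/2) * p k * real (n1 k) * real (n2 k))"
  \<comment> \<open>The precision 1 / (m + 1) is positive and at most 1 for every m, starting from m
    = 0.\<close>
  have "?Q m \<longlonglongrightarrow> 1" for m by (rule genus_prob_lim) auto
  then obtain m where m: "filterlim m at_top sequentially" "(\<lambda>k. ?Q (m k) k) \<longlonglongrightarrow> 1"
    by (rule diagonal_limit)
  have "(\<lambda>k. 1 / real (Suc (m k))) \<longlonglongrightarrow> 0"
    using filterlim_compose[OF LIMSEQ_Suc[OF lim_1_over_n] m(1)] by simp
  then show ?thesis using m(2) by (intro exI[of _ "\<lambda>k. 1 / real (Suc (m k))"] conjI)
qed

end
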